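(* Let $1\le d\le n$ and let $I_d\subseteq k[x_1,\dots,x_n]$ ($k$ a field) be the ideal generated by all square-free monomials of degree $d$. Let $P$ be a partitioning, i.e. a choice for each $i\in[n]$ of a partition $\Sigma_i^d=P_{i,1}\cup\cdots\cup P_{i,r_i}$. Then the ideal $\widetilde{I_d}$ corresponding to $P$ is a polarization of $I_d$ if and only if the following holds: for any $i$, any $j\ne j'$, any $\sigma\in P_{i,j}$ and any $\tau\in P_{i,j'}$, there exists $\beta\subseteq\sigma\cup\tau$ with $|\beta|=d$ such that for all $t\in\beta$: if $\beta\setminus\{t\}\in P_{t,s}$, then $(\sigma\cup\{i\})\setminus\{t\}\in P_{t,s}$ or $(\tau\cup\{i\})\setminus\{t\}\in P_{t,s}$, or both.
   Context: Polarization: Let $J$ be a monomial ideal in $S=k[x_1,\dots,x_n]$. A polarization of $J$ is a square-free monomial ideal $\widetilde J$ in $\widetilde S=k[x_i^{(j)} : 1\le i\le n,\ 1\le j\le r_i]$ such that the sequence consisting of all $x_i^{(1)}-x_i^{(j)}$ ($1\le i\le n$, $2\le j\le r_i$) is a regular $\widetilde S/\widetilde J$-sequence and substituting $x_i^{(j)}\mapsto x_i$ carries $\widetilde J$ to $J$ (i.e. $\widetilde J\otimes\widetilde S/(\text{sequence})\cong J$). Notation: $\Gamma_d=\{\sigma\subseteq[n] : |\sigma|=d\}$ and $\Sigma_i^d=\{\sigma\in\Gamma_{d-1} : i\notin\sigma\}$. The parts $P_{i,1},\dots,P_{i,r_i}$ of $\Sigma_i^d$ are nonempty and pairwise disjoint.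 The ideal corresponding to the partitioning is the ideal $\widetilde{I_d}\subseteq\widetilde S$ generated by the monomials $m_\sigma=\prod_{i\in\sigma}x_i^{(j)}$, $\sigma\in\Gamma_d$, where for each $i\in\sigma$ the index $j$ is the one with $\sigma\setminus\{i\}\in P_{i,j}$. *)

theory Defs
  imports "HOL-Algebra.QuotRing" "HOL-Algebra.Module"
    "HOL-Library.Poly_Mapping" "HOL-Library.Disjoint_Sets"
begin

section \<open>Polynomial rings\<close>

text \<open>A polynomial is a finitely supported map from exponent vectors to coefficients;
  \<open>Poly_Mapping\<close> makes this type a commutative ring under convolution.\<close>

type_synonym ('v, 'a) mpol = "('v \<Rightarrow>\<^sub>0 nat) \<Rightarrow>\<^sub>0 'a"

text \<open>The ring \<open>k[x\<^sub>v : v \<in> V]\<close>. The type \<open>'v\<close> may have elements outside \<open>V\<close>, so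
  the variables that actually occur are restricted through the carrier.\<close>

definition mpoly_ring :: "'v set \<Rightarrow> ('v, 'a::field) mpol ring" where
  "mpoly_ring V =
     \<lparr>carrier = {p. \<forall>m\<in>Poly_Mapping.keys p. Poly_Mapping.keys m \<subseteq> V},
      mult = (*), one = 1, zero = 0, add = (+)\<rparr>"

definition monomial :: "('v \<Rightarrow>\<^sub>0 nat) \<Rightarrow> ('v, 'a::field) mpol" where
  "monomial m = Poly_Mapping.single m 1"

definition var :: "'v \<Rightarrow> ('v, 'a::field) mpol" where
  "var v = monomial (Poly_Mapping.single v 1)"

definition subst :: "('v \<Rightarrow> ('w, 'a::field) mpol) \<Rightarrow> ('v, 'a) mpol \<Rightarrow> ('w, 'a) mpol" where
  "subst g p = (\<Sum>m\<in>Poly_Mapping.keys p. Poly_Mapping.single 0 (Poly_Mapping.lookup p m) *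
     (\<Prod>v\<in>Poly_Mapping.keys m. g v ^ Poly_Mapping.lookup m v))"

definition monomial_ideal :: "'v set \<Rightarrow> ('v, 'a::field) mpol set \<Rightarrow> bool" where
  "monomial_ideal V J \<longleftrightarrow> (\<exists>M. (\<forall>m\<in>M. Poly_Mapping.keys m \<subseteq> V) \<and>
     J = Idl\<^bsub>mpoly_ring V\<^esub> (monomial ` M))"

definition squarefree_monomial_ideal :: "'v set \<Rightarrow> ('v, 'a::field) mpol set \<Rightarrow> bool" where
  "squarefree_monomial_ideal V J \<longleftrightarrow>
     (\<exists>M. (\<forall>m\<in>M. Poly_Mapping.keys m \<subseteq> V \<and> (\<forall>v. Poly_Mapping.lookup m v \<le> 1)) \<and>
        J = Idl\<^bsub>mpoly_ring V\<^esub> (monomial ` M))"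

lemma mpoly_ring_sel [simp]:
  "mult (mpoly_ring V) = (*)" "one (mpoly_ring V) = 1"
  "zero (mpoly_ring V) = 0" "add (mpoly_ring V) = (+)"
  by (simp_all add: mpoly_ring_def)

lemma mpoly_ring_carrier:
  "p \<in> carrier (mpoly_ring V) \<longleftrightarrow> (\<forall>m\<in>Poly_Mapping.keys p. Poly_Mapping.keys m \<subseteq> V)"
  by (simp add: mpoly_ring_def)

lemma mpoly_ring_mult_closed:
  assumes "p \<in> carrier (mpoly_ring V)" "q \<in> carrier (mpoly_ring V)"
  shows "p * q \<in> carrier (mpoly_ring V)"
proof -
  have "Poly_Mapping.keys m \<subseteq> V" if m: "m \<in> Poly_Mapping.keys (p * q)" for m
  proof -
    obtain a b where "m = a + b" "a \<in> Poly_Mapping.keys p" "b \<in> Poly_Mapping.keys q"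
      using keys_mult m by blast
    then show ?thesis
      using assms keys_add[of a b] unfolding mpoly_ring_carrier by blast
  qed
  then show ?thesis by (simp add: mpoly_ring_carrier)
qed

lemma cring_mpoly_ring: "cring (mpoly_ring V :: ('v, 'a::field) mpol ring)"
proof (rule cringI)
  show "abelian_group (mpoly_ring V :: ('v, 'a) mpol ring)"
  proof (rule abelian_groupI)
    fix p q :: "('v, 'a) mpol"
    assume p: "p \<in> carrier (mpoly_ring V)" and q: "q \<in> carrier (mpoly_ring V)"
    show "p \<oplus>\<^bsub>mpoly_ring V\<^esub> q \<in> carrier (mpoly_ring V)"
      using p q keys_add[of p q] by (auto simp: mpoly_ring_carrier)
  next
    fix p :: "('v, 'a) mpol"
    assume "p \<in> carrier (mpoly_ring V)"
    then have "- p \<in> carrier (mpoly_ring V)" by (simp add: mpoly_ring_carrier)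
    then show "\<exists>q\<in>carrier (mpoly_ring V). q \<oplus>\<^bsub>mpoly_ring V\<^esub> p = \<zero>\<^bsub>mpoly_ring V\<^esub>"
      by (auto intro!: bexI[of _ "- p"])
  qed (auto simp: mpoly_ring_carrier algebra_simps)
  show "Group.comm_monoid (mpoly_ring V :: ('v, 'a) mpol ring)"
    by (rule comm_monoidI)
      (auto simp: mpoly_ring_mult_closed algebra_simps, simp add: mpoly_ring_carrier)
qed (auto simp: algebra_simps)

section \<open>Regular sequences\<close>

definition quot_module :: "('a, 'b) ring_scheme \<Rightarrow> 'a set \<Rightarrow> ('a, 'a set) module" where
  "quot_module R I =
     \<lparr>carrier = carrier (R Quot I), mult = mult (R Quot I), one = one (R Quot I),
      zero = zero (R Quot I), add = add (R Quot I),
      smult = (\<lambda>a X. (I +>\<^bsub>R\<^esub> a) \<otimes>\<^bsub>R Quot I\<^esub> X)\<rparr>"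

lemma module_quot_module:
  assumes "cring R" "ideal I R"
  shows "module R (quot_module R I)"
proof -
  interpret R: cring R by fact
  interpret ideal I R by fact
  interpret Q: cring "R Quot I" by (rule quotient_is_cring) fact
  have hom: "(+>\<^bsub>R\<^esub>) I \<in> ring_hom R (R Quot I)"
    by (rule rcos_ring_hom)
  have [simp]: "carrier (quot_module R I) = carrier (R Quot I)"
    "zero (quot_module R I) = zero (R Quot I)" "add (quot_module R I) = add (R Quot I)"
    by (simp_all add: quot_module_def)
  have smult: "a \<odot>\<^bsub>quot_module R I\<^esub> X = (I +>\<^bsub>R\<^esub> a) \<otimes>\<^bsub>R Quot I\<^esub> X" for a X
    by (simp add: quot_module_def)
  have cl: "I +>\<^bsub>R\<^esub> a \<in> carrier (R Quot I)" if "a \<in> carrier R" for a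
    using ring_hom_closed[OF hom that] .
  show ?thesis
  proof (rule moduleI)
    show "abelian_group (quot_module R I)"
    proof (rule abelian_groupI)
      fix X assume "X \<in> carrier (quot_module R I)"
      then show "\<exists>Y\<in>carrier (quot_module R I).
          Y \<oplus>\<^bsub>quot_module R I\<^esub> X = \<zero>\<^bsub>quot_module R I\<^esub>"
        using Q.l_neg[of X] Q.a_inv_closed[of X] by auto
    qed (simp_all add: Q.a_ac)
  next
    fix a b X
    assume a: "a \<in> carrier R" and b: "b \<in> carrier R" and X: "X \<in> carrier (quot_module R I)"
    show "(a \<oplus>\<^bsub>R\<^esub> b) \<odot>\<^bsub>quot_module R I\<^esub> X =
        (a \<odot>\<^bsub>quot_module R I\<^esub> X) \<oplus>\<^bsub>quot_module R I\<^esub> (b \<odot>\<^bsub>quot_module R I\<^esub> X)"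
      using Q.l_distr[OF cl[OF a] cl[OF b], of X] X ring_hom_add[OF hom a b]
      by (simp add: smult)
  next
    fix a X Y
    assume a: "a \<in> carrier R"
      and X: "X \<in> carrier (quot_module R I)" and Y: "Y \<in> carrier (quot_module R I)"
    show "a \<odot>\<^bsub>quot_module R I\<^esub> (X \<oplus>\<^bsub>quot_module R I\<^esub> Y) =
        (a \<odot>\<^bsub>quot_module R I\<^esub> X) \<oplus>\<^bsub>quot_module R I\<^esub> (a \<odot>\<^bsub>quot_module R I\<^esub> Y)"
      using Q.r_distr[of X Y, OF _ _ cl[OF a]] X Y by (simp add: smult)
  next
    fix a b X
    assume a: "a \<in> carrier R" and b: "b \<in> carrier R" and X: "X \<in> carrier (quot_module R I)"
    show "(a \<otimes>\<^bsub>R\<^esub> b) \<odot>\<^bsub>quot_module R I\<^esub> X =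
        a \<odot>\<^bsub>quot_module R I\<^esub> (b \<odot>\<^bsub>quot_module R I\<^esub> X)"
      using Q.m_assoc[OF cl[OF a] cl[OF b], of X] X ring_hom_mult[OF hom a b]
      by (simp add: smult)
  next
    fix a X assume "a \<in> carrier R" "X \<in> carrier (quot_module R I)"
    then show "a \<odot>\<^bsub>quot_module R I\<^esub> X \<in> carrier (quot_module R I)"
      using cl by (simp add: smult)
  next
    fix X assume "X \<in> carrier (quot_module R I)"
    then show "\<one>\<^bsub>R\<^esub> \<odot>\<^bsub>quot_module R I\<^esub> X = X"
      using ring_hom_one[OF hom] by (simp add: smult)
  qed (rule assms)
qed

text \<open>The submodule \<open>(F)M\<close> of \<open>M\<close>.\<close>

definition ideal_smult :: "('a, 'b) ring_scheme \<Rightarrow> ('a, 'm, 'c) module_scheme \<Rightarrow> 'a set \<Rightarrow> 'm set"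
  where "ideal_smult R M F =
     \<Inter>{N. submodule N R M \<and> {f \<odot>\<^bsub>M\<^esub> x | f x. f \<in> F \<and> x \<in> carrier M} \<subseteq> N}"

text \<open>Each \<open>f\<^sub>k\<close> is a nonzerodivisor on \<open>M/(f\<^sub>0,\<dots>,f\<^bsub>k-1\<^esub>)M\<close>, and \<open>M \<noteq> (fs)M\<close>.\<close>

definition regular_sequence ::
  "('a, 'b) ring_scheme \<Rightarrow> ('a, 'm, 'c) module_scheme \<Rightarrow> 'a list \<Rightarrow> bool" where
  "regular_sequence R M fs \<longleftrightarrow>
     set fs \<subseteq> carrier R \<and>
     (\<forall>k<length fs. \<forall>x\<in>carrier M.
        (fs ! k) \<odot>\<^bsub>M\<^esub> x \<in> ideal_smult R M (set (take k fs)) \<longrightarrow>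
        x \<in> ideal_smult R M (set (take k fs))) \<and>
     ideal_smult R M (set fs) \<noteq> carrier M"

section \<open>Polarizations\<close>

text \<open>The variable \<open>x\<^sub>i\<^sup>(\<^sup>j\<^sup>)\<close> is indexed by the pair \<open>(i, j)\<close>.\<close>

definition pol_vars :: "nat \<Rightarrow> (nat \<Rightarrow> nat) \<Rightarrow> (nat \<times> nat) set" where
  "pol_vars n r = (SIGMA i:{1..n}. {1..r i})"

text \<open>All \<open>x\<^sub>i\<^sup>(\<^sup>1\<^sup>) - x\<^sub>i\<^sup>(\<^sup>j\<^sup>)\<close> with \<open>1 \<le> i \<le> n\<close> and \<open>2 \<le> j \<le> r\<^sub>i\<close>, in lexicographic order of \<open>(i, j)\<close>.\<close>

definition pol_sequence :: "nat \<Rightarrow> (nat \<Rightarrow> nat) \<Rightarrow> (nat \<times> nat, 'a::field) mpol list" where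
  "pol_sequence n r =
     concat (map (\<lambda>i. map (\<lambda>j. var (i, 1) - var (i, j)) [2..<Suc (r i)]) [1..<Suc n])"

definition is_polarization ::
  "nat \<Rightarrow> (nat \<Rightarrow> nat) \<Rightarrow> (nat, 'a::field) mpol set \<Rightarrow> (nat \<times> nat, 'a) mpol set \<Rightarrow> bool" where
  "is_polarization n r J J' \<longleftrightarrow>
     monomial_ideal {1..n} J \<and>
     squarefree_monomial_ideal (pol_vars n r) J' \<and>
     regular_sequence (mpoly_ring (pol_vars n r)) (quot_module (mpoly_ring (pol_vars n r)) J')
       (pol_sequence n r) \<and>
     subst (\<lambda>(i, j). var i) ` J' = J"

section \<open>Partitionings and their ideals\<close>

definition Gamma :: "nat \<Rightarrow> nat \<Rightarrow> nat set set" where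
  "Gamma n d = {\<sigma>. \<sigma> \<subseteq> {1..n} \<and> card \<sigma> = d}"

definition Sigma_set :: "nat \<Rightarrow> nat \<Rightarrow> nat \<Rightarrow> nat set set" where
  "Sigma_set n d i = {\<sigma> \<in> Gamma n (d - 1). i \<notin> \<sigma>}"

text \<open>\<open>P i j\<close> is the part \<open>P\<^bsub>i,j\<^esub>\<close>; it is meaningful only for \<open>i \<in> {1..n}\<close> and \<open>j \<in> {1..r i}\<close>.\<close>

definition partitioning ::
  "nat \<Rightarrow> nat \<Rightarrow> (nat \<Rightarrow> nat) \<Rightarrow> (nat \<Rightarrow> nat \<Rightarrow> nat set set) \<Rightarrow> bool" where
  "partitioning n d r P \<longleftrightarrow>
     (\<forall>i\<in>{1..n}. (\<forall>j\<in>{1..r i}. P i j \<noteq> {}) \<and> disjoint_family_on (P i) {1..r i} \<and>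
        (\<Union>j\<in>{1..r i}. P i j) = Sigma_set n d i)"

definition part_index :: "(nat \<Rightarrow> nat) \<Rightarrow> (nat \<Rightarrow> nat \<Rightarrow> nat set set) \<Rightarrow> nat \<Rightarrow> nat set \<Rightarrow> nat" where
  "part_index r P i \<rho> = (THE j. j \<in> {1..r i} \<and> \<rho> \<in> P i j)"

definition sqfree_ideal :: "nat \<Rightarrow> nat \<Rightarrow> (nat, 'a::field) mpol set" where
  "sqfree_ideal n d = Idl\<^bsub>mpoly_ring {1..n}\<^esub> {\<Prod>i\<in>\<sigma>. var i | \<sigma>. \<sigma> \<in> Gamma n d}"

definition partitioning_ideal ::
  "nat \<Rightarrow> nat \<Rightarrow> (nat \<Rightarrow> nat) \<Rightarrow> (nat \<Rightarrow> nat \<Rightarrow> nat set set) \<Rightarrow> (nat \<times> nat, 'a::field) mpol set" where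
  "partitioning_ideal n d r P =
     Idl\<^bsub>mpoly_ring (pol_vars n r)\<^esub>
       {\<Prod>i\<in>\<sigma>. var (i, part_index r P i (\<sigma> - {i})) | \<sigma>. \<sigma> \<in> Gamma n d}"

end

theory Submission
  imports Defs
begin

text \<open>The partial quotients of the sequence are again quotients by monomial ideals, in which the
  variables treated so far have been identified. Such an ideal is squarefree in \<open>u = x\<^sub>i\<^sup>(\<^sup>1\<^sup>)\<close> and
  \<open>v = x\<^sub>i\<^sup>(\<^sup>j\<^sup>)\<close>, hence \<open>u - v\<close> is a nonzerodivisor modulo it iff no monomial outside it is multiplied
  into it by both \<open>u\<close> and \<open>v\<close>. Minimal such monomials are \<open>lcm (m\<^sub>A / u, m\<^sub>B / v)\<close> for generators
  \<open>m\<^sub>A\<close>, \<open>m\<^sub>B\<close>, so this is the stated condition, except that nothing is required of the indices of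
  the variables \<open>x\<^sub>t\<close> with \<open>t < i\<close>, which are already identified. These requirements are recovered one
  \<open>t\<close> at a time from the condition for \<open>t\<close> itself.\<close>

subsection \<open>Regular sequences on quotient rings\<close>

text \<open>The partial quotients are never formed as rings of their own. They are read inside the
  one polynomial ring through a retraction that renames each treated variable to the one with upper
  index 1: membership in an ideal containing part of the sequence becomes membership of the renamed
  polynomial in a monomial ideal of the same ring. The sequence is ordered lexicographically in
  \<open>(i, j)\<close>. When \<open>(i, j)\<close> is reached, variables with first index below
  \<open>i\<close> have lost their upper index, those above \<open>i\<close> still carry it, and at
  \<open>i\<close> the indices below \<open>j\<close> are merged into 1. Hence two generators with
  indices \<open>a < b\<close> at \<open>i\<close> are compared at the step \<open>j = b\<close>,
  whatever \<open>a\<close> is; this is why the few differences with index 1 control all pairs of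
  parts. The obstacle is that regularity yields, at each \<open>i\<close>, a condition that depends
  on this order, while the stated condition does not. Closing the gap is purely combinatorial and
  involves no polynomials.\<close>

lemma quot_module_sel [simp]:
  "carrier (quot_module R I) = carrier (R Quot I)"
  "zero (quot_module R I) = zero (R Quot I)"
  "add (quot_module R I) = add (R Quot I)"
  "a \<odot>\<^bsub>quot_module R I\<^esub> X = (I +>\<^bsub>R\<^esub> a) \<otimes>\<^bsub>R Quot I\<^esub> X"
  by (simp_all add: quot_module_def)

text \<open>Every element of the quotient ring is a coset, so closure under scalars from
  \<open>R\<close> and from \<open>R Quot I\<close> is the same.\<close>

lemma submodule_quot_module_iff:
  assumes "cring R" "ideal I R"
  shows "submodule N R (quot_module R I) \<longleftrightarrow> ideal N (R Quot I)"
proof -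
  interpret R: cring R by fact
  interpret I: ideal I R by fact
  interpret Q: cring "R Quot I" by (rule I.quotient_is_cring) fact
  have hom: "(+>\<^bsub>R\<^esub>) I \<in> ring_hom R (R Quot I)"
    by (rule I.rcos_ring_hom)
  have add: "subgroup N (add_monoid (quot_module R I)) \<longleftrightarrow> subgroup N (add_monoid (R Quot I))"
    unfolding subgroup_def m_inv_def by simp
  have surj: "\<exists>a\<in>carrier R. x = I +>\<^bsub>R\<^esub> a" if "x \<in> carrier (R Quot I)" for x
    using that unfolding FactRing_def A_RCOSETS_def' by auto
  show ?thesis
  proof
    assume N: "submodule N R (quot_module R I)"
    then have sub: "subgroup N (add_monoid (R Quot I))"
      unfolding submodule_def add by blast
    have l: "x \<otimes>\<^bsub>R Quot I\<^esub> a \<in> N" if a: "a \<in> N" and x: "x \<in> carrier (R Quot I)" for a x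
      using surj[OF x] submodule.smult_closed[OF N _ a] by auto
    have r: "a \<otimes>\<^bsub>R Quot I\<^esub> x \<in> N" if a: "a \<in> N" and x: "x \<in> carrier (R Quot I)" for a x
      using l[OF a x] Q.m_comm[of a x] subgroup.mem_carrier[OF sub a] x by simp
    show "ideal N (R Quot I)"
      by (rule idealI) (use sub l r Q.ring_axioms in auto)
  next
    assume "ideal N (R Quot I)"
    then interpret N: ideal N "R Quot I" .
    show "submodule N R (quot_module R I)"
      unfolding submodule_def submodule_axioms_def add
      using N.a_subgroup N.I_l_closed ring_hom_closed[OF hom] by auto
  qed
qed

text \<open>Ideals of the quotient correspond to ideals of \<open>R\<close> containing
  \<open>I\<close>: one direction pushes the ideal generated by \<open>I \<union> F\<close> forward
  along the quotient map, the other pulls a submodule back.\<close>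

lemma rcoset_mem_ideal_smult_iff:
  assumes "cring R" and I: "ideal I R" and F: "F \<subseteq> carrier R" and a: "a \<in> carrier R"
  shows "I +>\<^bsub>R\<^esub> a \<in> ideal_smult R (quot_module R I) F \<longleftrightarrow> a \<in> Idl\<^bsub>R\<^esub> (I \<union> F)"
proof -
  interpret R: cring R by fact
  interpret I: ideal I R by fact
  interpret Q: cring "R Quot I" by (rule I.quotient_is_cring) fact
  interpret h: ring_hom_cring R "R Quot I" "(+>\<^bsub>R\<^esub>) I"
    by (rule I.rcos_ring_hom_cring) fact
  have sub: "I \<union> F \<subseteq> carrier R"
    using F I.a_subset by auto
  interpret J: ideal "Idl\<^bsub>R\<^esub> (I \<union> F)" R
    by (rule R.genideal_ideal[OF sub])
  have eq: "ideal_smult R (quot_module R I) F =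
      \<Inter>{N. ideal N (R Quot I) \<and>
        {(I +>\<^bsub>R\<^esub> f) \<otimes>\<^bsub>R Quot I\<^esub> x | f x. f \<in> F \<and> x \<in> carrier (R Quot I)} \<subseteq> N}"
    unfolding ideal_smult_def submodule_quot_module_iff[OF assms(1,2)] by simp
  show ?thesis
  proof
    assume l: "I +>\<^bsub>R\<^esub> a \<in> ideal_smult R (quot_module R I) F"
    let ?N = "(+>\<^bsub>R\<^esub>) I ` (Idl\<^bsub>R\<^esub> (I \<union> F))"
    have N: "ideal ?N (R Quot I)"
      by (rule R.ring_ideal_imp_quot_ideal[OF I J.is_ideal])
    have "(I +>\<^bsub>R\<^esub> f) \<otimes>\<^bsub>R Quot I\<^esub> x \<in> ?N" if "f \<in> F" "x \<in> carrier (R Quot I)" for f x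
    proof (rule ideal.I_r_closed[OF N _ that(2)])
      show "I +>\<^bsub>R\<^esub> f \<in> ?N"
        using R.genideal_self[OF sub] that by blast
    qed
    then have "I +>\<^bsub>R\<^esub> a \<in> ?N"
      using l N unfolding eq by blast
    then obtain b where b: "b \<in> Idl\<^bsub>R\<^esub> (I \<union> F)" and ab: "I +>\<^bsub>R\<^esub> a = I +>\<^bsub>R\<^esub> b"
      by blast
    have bc: "b \<in> carrier R" using J.Icarr[OF b] .
    have "a \<ominus>\<^bsub>R\<^esub> b \<in> I"
      using R.quotient_eq_iff_same_a_r_cos[OF I a bc] ab by simp
    then have "a \<ominus>\<^bsub>R\<^esub> b \<in> Idl\<^bsub>R\<^esub> (I \<union> F)"
      using R.genideal_self[OF sub] by blast
    then have "(a \<ominus>\<^bsub>R\<^esub> b) \<oplus>\<^bsub>R\<^esub> b \<in> Idl\<^bsub>R\<^esub> (I \<union> F)"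
      using b by (rule J.a_closed)
    then show "a \<in> Idl\<^bsub>R\<^esub> (I \<union> F)"
      using a bc by (simp add: R.minus_eq R.a_assoc R.l_neg)
  next
    assume ra: "a \<in> Idl\<^bsub>R\<^esub> (I \<union> F)"
    show "I +>\<^bsub>R\<^esub> a \<in> ideal_smult R (quot_module R I) F"
      unfolding eq
    proof clarify
      fix N
      assume N: "ideal N (R Quot I)"
        and sN: "{(I +>\<^bsub>R\<^esub> f) \<otimes>\<^bsub>R Quot I\<^esub> x | f x. f \<in> F \<and> x \<in> carrier (R Quot I)} \<subseteq> N"
      interpret N: ideal N "R Quot I" by fact
      let ?K = "{r \<in> carrier R. I +>\<^bsub>R\<^esub> r \<in> N}"
      have K: "ideal ?K R"
        by (rule h.ring.ideal_vimage[OF N])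
      have "I +>\<^bsub>R\<^esub> f \<in> N" if f: "f \<in> F" for f
      proof -
        have "(I +>\<^bsub>R\<^esub> f) \<otimes>\<^bsub>R Quot I\<^esub> \<one>\<^bsub>R Quot I\<^esub> \<in> N"
          using sN f by blast
        then show ?thesis using f F by auto
      qed
      moreover have "I +>\<^bsub>R\<^esub> f \<in> N" if f: "f \<in> I" for f
        using N.zero_closed R.a_rcos_zero[OF I f] unfolding FactRing_def by simp
      ultimately have "I \<union> F \<subseteq> ?K" using sub by auto
      then show "I +>\<^bsub>R\<^esub> a \<in> N"
        using R.genideal_minimal[OF K] ra by blast
    qed
  qed
qed

text \<open>Removes modules and cosets from the definition. The nontriviality clause becomes a
  statement about 1 because an ideal is proper exactly when it misses 1.\<close>

lemma regular_sequence_quot_module_iff: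
  assumes "cring R" and I: "ideal I R"
  shows "regular_sequence R (quot_module R I) fs \<longleftrightarrow>
    set fs \<subseteq> carrier R \<and>
    (\<forall>k<length fs. \<forall>a\<in>carrier R. fs ! k \<otimes>\<^bsub>R\<^esub> a \<in> Idl\<^bsub>R\<^esub> (I \<union> set (take k fs)) \<longrightarrow>
       a \<in> Idl\<^bsub>R\<^esub> (I \<union> set (take k fs))) \<and>
    \<one>\<^bsub>R\<^esub> \<notin> Idl\<^bsub>R\<^esub> (I \<union> set fs)"
proof (cases "set fs \<subseteq> carrier R")
  case fs: True
  interpret R: cring R by fact
  interpret I: ideal I R by fact
  interpret Q: cring "R Quot I" by (rule I.quotient_is_cring) fact
  interpret h: ring_hom_cring R "R Quot I" "(+>\<^bsub>R\<^esub>) I"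
    by (rule I.rcos_ring_hom_cring) fact
  have surj: "carrier (R Quot I) = (\<lambda>a. I +>\<^bsub>R\<^esub> a) ` carrier R"
    unfolding FactRing_def A_RCOSETS_def' by auto
  have take: "set (take k fs) \<subseteq> carrier R" for k
    using fs set_take_subset by fastforce
  have step: "(\<forall>x\<in>carrier (quot_module R I).
        (fs ! k) \<odot>\<^bsub>quot_module R I\<^esub> x \<in> ideal_smult R (quot_module R I) (set (take k fs)) \<longrightarrow>
        x \<in> ideal_smult R (quot_module R I) (set (take k fs))) \<longleftrightarrow>
      (\<forall>a\<in>carrier R. fs ! k \<otimes>\<^bsub>R\<^esub> a \<in> Idl\<^bsub>R\<^esub> (I \<union> set (take k fs)) \<longrightarrow>
        a \<in> Idl\<^bsub>R\<^esub> (I \<union> set (take k fs)))" if "k < length fs" for k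
  proof -
    have fk: "fs ! k \<in> carrier R" using that fs by auto
    have "(I +>\<^bsub>R\<^esub> (fs ! k)) \<otimes>\<^bsub>R Quot I\<^esub> (I +>\<^bsub>R\<^esub> a) \<in> ideal_smult R (quot_module R I) (set (take k fs))
        \<longleftrightarrow> fs ! k \<otimes>\<^bsub>R\<^esub> a \<in> Idl\<^bsub>R\<^esub> (I \<union> set (take k fs))" if "a \<in> carrier R" for a
      using rcoset_mem_ideal_smult_iff[OF assms take, of "fs ! k \<otimes>\<^bsub>R\<^esub> a"] fk that by simp
    then show ?thesis
      using rcoset_mem_ideal_smult_iff[OF assms take] unfolding quot_module_sel surj by simp
  qed
  have "ideal_smult R (quot_module R I) (set fs) = carrier (R Quot I) \<longleftrightarrow>
      \<one>\<^bsub>R\<^esub> \<in> Idl\<^bsub>R\<^esub> (I \<union> set fs)"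
  proof
    assume "ideal_smult R (quot_module R I) (set fs) = carrier (R Quot I)"
    then show "\<one>\<^bsub>R\<^esub> \<in> Idl\<^bsub>R\<^esub> (I \<union> set fs)"
      using rcoset_mem_ideal_smult_iff[OF assms fs] by auto
  next
    assume 1: "\<one>\<^bsub>R\<^esub> \<in> Idl\<^bsub>R\<^esub> (I \<union> set fs)"
    have "Idl\<^bsub>R\<^esub> (I \<union> set fs) = carrier R"
      using ideal.one_imp_carrier[OF R.genideal_ideal 1] fs I.a_subset by auto
    then have "carrier (R Quot I) \<subseteq> ideal_smult R (quot_module R I) (set fs)"
      using rcoset_mem_ideal_smult_iff[OF assms fs] unfolding surj by auto
    moreover have "ideal_smult R (quot_module R I) (set fs) \<subseteq> carrier (R Quot I)"
    proof -
      have "submodule (carrier (R Quot I)) R (quot_module R I)"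
        by (simp add: submodule_quot_module_iff[OF assms] Q.oneideal)
      moreover have "{f \<odot>\<^bsub>quot_module R I\<^esub> x | f x. f \<in> set fs \<and> x \<in> carrier (quot_module R I)}
          \<subseteq> carrier (R Quot I)"
        using fs by auto
      ultimately show ?thesis
        unfolding ideal_smult_def by blast
    qed
    ultimately show "ideal_smult R (quot_module R I) (set fs) = carrier (R Quot I)" by blast
  qed
  then show ?thesis
    unfolding regular_sequence_def using step fs by simp
qed (simp add: regular_sequence_def)

subsection \<open>Polynomials and monomial ideals\<close>

text \<open>Divisibility of monomials; the order \<open>\<le>\<close> of \<open>Poly_Mapping\<close> is lexicographic.\<close>

definition exp_le :: "('v \<Rightarrow>\<^sub>0 nat) \<Rightarrow> ('v \<Rightarrow>\<^sub>0 nat) \<Rightarrow> bool" where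
  "exp_le g m \<longleftrightarrow> (\<forall>v. Poly_Mapping.lookup g v \<le> Poly_Mapping.lookup m v)"

lemma exp_leD: "exp_le g m \<Longrightarrow> Poly_Mapping.lookup g v \<le> Poly_Mapping.lookup m v"
  by (simp add: exp_le_def)

lemma exp_le_refl: "exp_le m m"
  by (simp add: exp_le_def)

lemma exp_le_trans: "exp_le a b \<Longrightarrow> exp_le b c \<Longrightarrow> exp_le a c"
  unfolding exp_le_def using le_trans by blast

lemma exp_le_add: "exp_le m (a + m)"
  by (simp add: exp_le_def lookup_add)

lemma exp_le_imp_eq_add:
  assumes "exp_le g m"
  shows "m = (m - g) + g"
  using assms by (intro poly_mapping_eqI) (simp add: exp_le_def lookup_add lookup_minus)

lemma keys_diff_subset:
  fixes m g :: "'v \<Rightarrow>\<^sub>0 nat"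
  shows "Poly_Mapping.keys (m - g) \<subseteq> Poly_Mapping.keys m"
  by (auto simp: in_keys_iff lookup_minus)

lemma lookup_single_mult_add:
  fixes a m :: "'v \<Rightarrow>\<^sub>0 nat" and p :: "('v, 'a::field) mpol"
  shows "Poly_Mapping.lookup (Poly_Mapping.single a c * p) (a + m) = c * Poly_Mapping.lookup p m"
  by (simp add: lookup_mult lookup_single when_mult)

lemma lookup_single_mult_eq_0:
  fixes a k :: "'v \<Rightarrow>\<^sub>0 nat" and p :: "('v, 'a::field) mpol"
  assumes "\<not> exp_le a k"
  shows "Poly_Mapping.lookup (Poly_Mapping.single a c * p) k = 0"
proof -
  have "k \<noteq> a + q" for q
    using assms by (auto simp: exp_le_def lookup_add)
  then show ?thesis
    by (simp add: lookup_mult lookup_single when_mult)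
qed

lemma mpoly_sum_singles:
  fixes p :: "('v, 'a::field) mpol"
  shows "p = (\<Sum>m\<in>Poly_Mapping.keys p. Poly_Mapping.single m (Poly_Mapping.lookup p m))"
proof (rule poly_mapping_eqI)
  fix k
  show "Poly_Mapping.lookup p k =
      Poly_Mapping.lookup (\<Sum>m\<in>Poly_Mapping.keys p. Poly_Mapping.single m (Poly_Mapping.lookup p m)) k"
    by (cases "k \<in> Poly_Mapping.keys p")
      (auto simp: lookup_sum lookup_single when_def in_keys_iff intro!: sum.neutral)
qed

lemma monomial_0 [simp]: "monomial 0 = 1"
  by (simp add: monomial_def)

lemma monomial_add: "monomial (a + b) = monomial a * monomial b"
  by (simp add: monomial_def mult_single)

lemma monomial_sum: "monomial (\<Sum>x\<in>A. f x) = (\<Prod>x\<in>A. monomial (f x))"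
  by (induction A rule: infinite_finite_induct) (auto simp: monomial_add)

lemma keys_monomial [simp]: "Poly_Mapping.keys (monomial m :: ('v, 'a::field) mpol) = {m}"
  by (simp add: monomial_def)

lemma var_power: "var v ^ k = monomial (Poly_Mapping.single v k)"
  by (induction k) (auto simp: var_def monomial_add [symmetric] single_add [symmetric])

lemma exponent_sum_singles:
  fixes m :: "'v \<Rightarrow>\<^sub>0 nat"
  shows "m = (\<Sum>v\<in>Poly_Mapping.keys m. Poly_Mapping.single v (Poly_Mapping.lookup m v))"
proof (rule poly_mapping_eqI)
  fix k
  show "Poly_Mapping.lookup m k =
      Poly_Mapping.lookup (\<Sum>v\<in>Poly_Mapping.keys m. Poly_Mapping.single v (Poly_Mapping.lookup m v)) k"
    by (cases "k \<in> Poly_Mapping.keys m")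
      (auto simp: lookup_sum lookup_single when_def in_keys_iff intro!: sum.neutral)
qed

lemma monomial_eq_prod_var:
  "monomial m = (\<Prod>v\<in>Poly_Mapping.keys m. var v ^ Poly_Mapping.lookup m v)"
  by (subst exponent_sum_singles) (simp add: monomial_sum var_power)

lemma single_eq_const_mult_monomial:
  "Poly_Mapping.single m c = Poly_Mapping.single 0 c * monomial m"
  by (simp add: monomial_def mult_single)

context
  fixes V :: "'v set"
begin

lemma const_in_carrier: "Poly_Mapping.single 0 c \<in> carrier (mpoly_ring V)"
  by (auto simp: mpoly_ring_carrier)

lemma zero_in_carrier: "0 \<in> carrier (mpoly_ring V)"
  by (auto simp: mpoly_ring_carrier)

lemma one_in_carrier: "1 \<in> carrier (mpoly_ring V)"
  by (auto simp: mpoly_ring_carrier)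

lemma add_in_carrier:
  "p \<in> carrier (mpoly_ring V) \<Longrightarrow> q \<in> carrier (mpoly_ring V) \<Longrightarrow> p + q \<in> carrier (mpoly_ring V)"
  using keys_add[of p q] by (auto simp: mpoly_ring_carrier)

lemma uminus_in_carrier: "p \<in> carrier (mpoly_ring V) \<Longrightarrow> - p \<in> carrier (mpoly_ring V)"
  by (simp add: mpoly_ring_carrier)

lemma diff_in_carrier:
  "p \<in> carrier (mpoly_ring V) \<Longrightarrow> q \<in> carrier (mpoly_ring V) \<Longrightarrow> p - q \<in> carrier (mpoly_ring V)"
  using add_in_carrier[of p "- q"] uminus_in_carrier[of q] by simp

lemma monomial_in_carrier:
  "(monomial m :: ('v, 'a::field) mpol) \<in> carrier (mpoly_ring V) \<longleftrightarrow> Poly_Mapping.keys m \<subseteq> V"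
  by (simp add: mpoly_ring_carrier)

lemma var_in_carrier: "v \<in> V \<Longrightarrow> (var v :: ('v, 'a::field) mpol) \<in> carrier (mpoly_ring V)"
  by (simp add: var_def monomial_in_carrier)

lemma prod_in_carrier:
  "(\<And>x. x \<in> A \<Longrightarrow> f x \<in> carrier (mpoly_ring V)) \<Longrightarrow> (\<Prod>x\<in>A. f x) \<in> carrier (mpoly_ring V)"
  by (induction A rule: infinite_finite_induct)
    (auto intro: one_in_carrier mpoly_ring_mult_closed)

text \<open>Facts about substitutions need only be checked on constants and variables; sums and
  products then reach every polynomial of the carrier.\<close>

lemma mpoly_carrier_induct [consumes 1, case_names const var add mult]:
  fixes p :: "('v, 'a::field) mpol"
  assumes p: "p \<in> carrier (mpoly_ring V)"
    and const: "\<And>c. Q (Poly_Mapping.single 0 c)"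
    and var: "\<And>v. v \<in> V \<Longrightarrow> Q (var v)"
    and add: "\<And>p q. p \<in> carrier (mpoly_ring V) \<Longrightarrow> q \<in> carrier (mpoly_ring V) \<Longrightarrow>
      Q p \<Longrightarrow> Q q \<Longrightarrow> Q (p + q)"
    and mult: "\<And>p q. p \<in> carrier (mpoly_ring V) \<Longrightarrow> q \<in> carrier (mpoly_ring V) \<Longrightarrow>
      Q p \<Longrightarrow> Q q \<Longrightarrow> Q (p * q)"
  shows "Q p"
proof -
  let ?R = "mpoly_ring V :: ('v, 'a) mpol ring"
  have zero: "Q 0" and one: "Q 1"
    using const[of 0] const[of 1] by simp_all
  have pow: "var v ^ k \<in> carrier ?R \<and> Q (var v ^ k)" if "v \<in> V" for v k
    by (induction k)
      (auto intro: one mult var that one_in_carrier mpoly_ring_mult_closed var_in_carrier)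
  have prod: "(\<Prod>v\<in>A. var v ^ f v) \<in> carrier ?R \<and> Q (\<Prod>v\<in>A. var v ^ f v)" if "A \<subseteq> V" for A f
    using that by (induction A rule: infinite_finite_induct)
      (auto simp: pow intro: one mult one_in_carrier mpoly_ring_mult_closed)
  have single: "Poly_Mapping.single m c \<in> carrier ?R \<and> Q (Poly_Mapping.single m c)"
    if "Poly_Mapping.keys m \<subseteq> V" for m c
    unfolding single_eq_const_mult_monomial[of m c] monomial_eq_prod_var
    using prod[OF that] by (auto intro: mult const const_in_carrier mpoly_ring_mult_closed)
  have "(\<Sum>m\<in>A. Poly_Mapping.single m (f m)) \<in> carrier ?R \<and> Q (\<Sum>m\<in>A. Poly_Mapping.single m (f m))"
    if "\<And>m. m \<in> A \<Longrightarrow> Poly_Mapping.keys m \<subseteq> V" for A f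
    using that by (induction A rule: infinite_finite_induct)
      (auto simp: single intro: zero add zero_in_carrier add_in_carrier)
  then have "Q (\<Sum>m\<in>Poly_Mapping.keys p. Poly_Mapping.single m (Poly_Mapping.lookup p m))"
    using p by (auto simp: mpoly_ring_carrier)
  then show ?thesis using mpoly_sum_singles[of p] by simp
qed

lemma ideal_mpoly_ringI:
  fixes N :: "('v, 'a::field) mpol set"
  assumes sub: "N \<subseteq> carrier (mpoly_ring V)" and zero: "0 \<in> N"
    and add: "\<And>p q. p \<in> N \<Longrightarrow> q \<in> N \<Longrightarrow> p + q \<in> N"
    and mult: "\<And>p q. p \<in> N \<Longrightarrow> q \<in> carrier (mpoly_ring V) \<Longrightarrow> q * p \<in> N"
  shows "ideal N (mpoly_ring V)"
proof -
  interpret R: cring "mpoly_ring V :: ('v, 'a) mpol ring"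
    by (rule cring_mpoly_ring)
  have inv: "\<ominus>\<^bsub>mpoly_ring V\<^esub> p = - p" if "p \<in> carrier (mpoly_ring V)" for p :: "('v, 'a) mpol"
    by (rule R.minus_equality) (use that uminus_in_carrier in auto)
  have neg: "- p \<in> N" if "p \<in> N" for p
    using mult[OF that, of "- 1"] uminus_in_carrier[OF one_in_carrier] by simp
  have "subgroup N (add_monoid (mpoly_ring V))"
  proof (rule R.add.subgroupI)
    show "\<ominus>\<^bsub>mpoly_ring V\<^esub> a \<in> N" if "a \<in> N" for a
      using that neg inv sub by auto
  qed (use sub zero add in auto)
  then show ?thesis
    by (intro idealI) (use mult R.ring_axioms in \<open>auto simp: mult.commute\<close>)
qed

lemma ideal_mpoly_ring_uminus:
  assumes "ideal N (mpoly_ring V)" "(p :: ('v, 'a::field) mpol) \<in> N"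
  shows "- p \<in> N"
  using ideal.I_l_closed[OF assms uminus_in_carrier[OF one_in_carrier]] by simp

text \<open>The polynomials all of whose monomials are multiples of generators form an ideal;
  conversely each term of such a polynomial is a multiple of a generator. Membership thus becomes a
  test on single monomials.\<close>

lemma mem_monomial_ideal_iff:
  fixes p :: "('v, 'a::field) mpol"
  assumes M: "\<And>m. m \<in> M \<Longrightarrow> Poly_Mapping.keys m \<subseteq> V"
  shows "p \<in> Idl\<^bsub>mpoly_ring V\<^esub> (monomial ` M) \<longleftrightarrow>
    p \<in> carrier (mpoly_ring V) \<and> (\<forall>m\<in>Poly_Mapping.keys p. \<exists>g\<in>M. exp_le g m)"
proof -
  let ?R = "mpoly_ring V :: ('v, 'a) mpol ring"
  interpret R: cring ?R by (rule cring_mpoly_ring)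
  have gens: "monomial ` M \<subseteq> carrier ?R"
    using M by (auto simp: monomial_in_carrier)
  interpret J: ideal "Idl\<^bsub>?R\<^esub> (monomial ` M)" ?R
    by (rule R.genideal_ideal[OF gens])
  let ?N = "{p \<in> carrier ?R. \<forall>m\<in>Poly_Mapping.keys p. \<exists>g\<in>M. exp_le g m}"
  have "ideal ?N ?R"
  proof (rule ideal_mpoly_ringI)
    fix p q assume p: "p \<in> ?N" and q: "q \<in> carrier ?R"
    have "\<exists>g\<in>M. exp_le g m" if "m \<in> Poly_Mapping.keys (q * p)" for m
    proof -
      obtain a b where m: "m = a + b" and b: "b \<in> Poly_Mapping.keys p"
        using keys_mult[of q p] \<open>m \<in> Poly_Mapping.keys (q * p)\<close> by blast
      then obtain g where "g \<in> M" "exp_le g b" using p by auto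
      then show ?thesis unfolding m by (blast intro: exp_le_trans exp_le_add)
    qed
    then show "q * p \<in> ?N" using p q by (simp add: mpoly_ring_mult_closed)
  next
    fix p q assume "p \<in> ?N" "q \<in> ?N"
    then show "p + q \<in> ?N" using keys_add[of p q] by (auto simp: add_in_carrier)
  qed (auto simp: zero_in_carrier)
  moreover have "monomial ` M \<subseteq> ?N"
    using gens by (auto intro: exp_le_refl)
  ultimately have sub: "Idl\<^bsub>?R\<^esub> (monomial ` M) \<subseteq> ?N"
    by (rule R.genideal_minimal)
  have "p \<in> Idl\<^bsub>?R\<^esub> (monomial ` M)" if p: "p \<in> ?N"
  proof -
    have single: "Poly_Mapping.single m c \<in> Idl\<^bsub>?R\<^esub> (monomial ` M)"
      if m: "m \<in> Poly_Mapping.keys p" for m c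
    proof -
      obtain g where g: "g \<in> M" "exp_le g m" using p m by auto
      have "Poly_Mapping.keys (m - g) \<subseteq> V"
        using keys_diff_subset[of m g] p m by (auto simp: mpoly_ring_carrier)
      then have "Poly_Mapping.single (m - g) c \<in> carrier ?R"
        by (auto simp: mpoly_ring_carrier)
      moreover have "monomial g \<in> Idl\<^bsub>?R\<^esub> (monomial ` M)"
        using R.genideal_self[OF gens] g by auto
      moreover have "Poly_Mapping.single m c = Poly_Mapping.single (m - g) c * monomial g"
        using exp_le_imp_eq_add[OF g(2)] by (simp add: monomial_def mult_single)
      ultimately show ?thesis using J.I_l_closed by fastforce
    qed
    have sum: "(\<Sum>m\<in>A. f m) \<in> Idl\<^bsub>?R\<^esub> (monomial ` M)"
      if "\<And>m. m \<in> A \<Longrightarrow> f m \<in> Idl\<^bsub>?R\<^esub> (monomial ` M)"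
      for A :: "('v \<Rightarrow>\<^sub>0 nat) set" and f
      using that J.zero_closed J.a_closed
      by (induction A rule: infinite_finite_induct) auto
    have "(\<Sum>m\<in>Poly_Mapping.keys p. Poly_Mapping.single m (Poly_Mapping.lookup p m)) \<in> Idl\<^bsub>?R\<^esub> (monomial ` M)"
      by (rule sum) (rule single)
    then show ?thesis using mpoly_sum_singles[of p] by simp
  qed
  then show ?thesis using sub by blast
qed

end

section \<open>Substitution as a ring homomorphism\<close>

definition monomial_value :: "('v \<Rightarrow> ('w, 'a::field) mpol) \<Rightarrow> ('v \<Rightarrow>\<^sub>0 nat) \<Rightarrow> ('w, 'a) mpol" where
  "monomial_value g m = (\<Prod>v\<in>Poly_Mapping.keys m. g v ^ Poly_Mapping.lookup m v)"

text \<open>A sum and its summands have different supports; they are compared over a common finite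
  superset, where the extra factors are zeroth powers.\<close>

lemma monomial_value_superset:
  assumes "finite A" "Poly_Mapping.keys m \<subseteq> A"
  shows "monomial_value g m = (\<Prod>v\<in>A. g v ^ Poly_Mapping.lookup m v)"
  unfolding monomial_value_def
  by (rule prod.mono_neutral_left) (use assms in \<open>auto simp: in_keys_iff\<close>)

lemma monomial_value_add: "monomial_value g (a + b) = monomial_value g a * monomial_value g b"
proof -
  let ?A = "Poly_Mapping.keys a \<union> Poly_Mapping.keys b"
  have "monomial_value g m = (\<Prod>v\<in>?A. g v ^ Poly_Mapping.lookup m v)" if "m \<in> {a, b, a + b}" for m
    by (rule monomial_value_superset) (use that keys_add[of a b] in auto)
  then show ?thesis
    by (simp add: lookup_add power_add prod.distrib)
qed

lemma subst_superset:
  assumes "finite A" "Poly_Mapping.keys p \<subseteq> A"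
  shows "subst g p = (\<Sum>m\<in>A. Poly_Mapping.single 0 (Poly_Mapping.lookup p m) * monomial_value g m)"
  unfolding subst_def monomial_value_def[symmetric]
  by (rule sum.mono_neutral_left) (use assms in \<open>auto simp: in_keys_iff\<close>)

lemma subst_add: "subst g (p + q) = subst g p + subst g q"
proof -
  let ?A = "Poly_Mapping.keys p \<union> Poly_Mapping.keys q"
  have "subst g r = (\<Sum>m\<in>?A. Poly_Mapping.single 0 (Poly_Mapping.lookup r m) * monomial_value g m)"
    if "r \<in> {p, q, p + q}" for r
    by (rule subst_superset) (use that keys_add[of p q] in auto)
  then show ?thesis
    by (simp add: lookup_add single_add distrib_right sum.distrib)
qed

lemma subst_0 [simp]: "subst g 0 = 0"
  by (simp add: subst_def)

lemma subst_sum: "subst g (\<Sum>x\<in>A. f x) = (\<Sum>x\<in>A. subst g (f x))"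
  by (induction A rule: infinite_finite_induct) (auto simp: subst_add)

lemma subst_single: "subst g (Poly_Mapping.single m c) = Poly_Mapping.single 0 c * monomial_value g m"
  \<comment> \<open>The set \<open>{m}\<close> replaces the support, which is empty when
    \<open>c = 0\<close>.\<close>
  using subst_superset[of "{m}" "Poly_Mapping.single m c" g] by simp

lemma subst_mult:
  fixes g :: "'v \<Rightarrow> ('w, 'a::field) mpol"
  shows "subst g (p * q) = subst g p * subst g q"
proof -
  have single: "subst g (Poly_Mapping.single a c * Poly_Mapping.single b e) =
      subst g (Poly_Mapping.single a c) * subst g (Poly_Mapping.single b e)" for a b c e
  proof -
    have "(Poly_Mapping.single 0 (c * e) :: ('w, 'a) mpol) =
        Poly_Mapping.single 0 c * Poly_Mapping.single 0 e"
      by (simp add: mult_single)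
    then show ?thesis
      by (simp add: mult_single[of a] subst_single monomial_value_add mult_ac)
  qed
  let ?s = "\<lambda>p. \<Sum>m\<in>Poly_Mapping.keys p. Poly_Mapping.single m (Poly_Mapping.lookup p m)"
  have "subst g (?s p * ?s q) = subst g (?s p) * subst g (?s q)"
    by (simp add: sum_product subst_sum single)
  then show ?thesis
    using mpoly_sum_singles[of p] mpoly_sum_singles[of q] by simp
qed

lemma subst_const [simp]: "subst g (Poly_Mapping.single 0 c) = Poly_Mapping.single 0 c"
  by (simp add: subst_single monomial_value_def)

lemma subst_1 [simp]: "subst g 1 = 1"
  using subst_const[of g 1] by simp

lemma subst_var [simp]: "subst g (var v) = g v"
  by (simp add: var_def monomial_def subst_single monomial_value_def)

lemma subst_uminus: "subst g (- p) = - subst g p"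
  using subst_add[of g p "- p"] by (simp add: eq_neg_iff_add_eq_0 add.commute)

lemma subst_diff: "subst g (p - q) = subst g p - subst g q"
  using subst_add[of g p "- q"] by (simp add: subst_uminus)

lemma subst_prod: "subst g (\<Prod>x\<in>A. f x) = (\<Prod>x\<in>A. subst g (f x))"
  by (induction A rule: infinite_finite_induct) (auto simp: subst_mult)

lemma subst_in_carrier:
  assumes "p \<in> carrier (mpoly_ring V)" "\<And>v. v \<in> V \<Longrightarrow> g v \<in> carrier (mpoly_ring W)"
  shows "subst g p \<in> carrier (mpoly_ring W)"
  using assms
  by (induction p rule: mpoly_carrier_induct)
    (auto simp: subst_add subst_mult const_in_carrier add_in_carrier mpoly_ring_mult_closed)

lemma subst_subst_id:
  assumes "p \<in> carrier (mpoly_ring V)" "\<And>v. v \<in> V \<Longrightarrow> subst f (g v) = var v"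
  shows "subst f (subst g p) = p"
  using assms
  by (induction p rule: mpoly_carrier_induct) (auto simp: subst_add subst_mult)

lemma ideal_mpoly_vimage:
  fixes g :: "'v \<Rightarrow> ('w, 'a::field) mpol"
  assumes "ideal J (mpoly_ring W)" "\<And>v. v \<in> V \<Longrightarrow> g v \<in> carrier (mpoly_ring W)"
  shows "ideal {p \<in> carrier (mpoly_ring V). subst g p \<in> J} (mpoly_ring V)"
proof -
  interpret R: cring "mpoly_ring W :: ('w, 'a) mpol ring" by (rule cring_mpoly_ring)
  interpret J: ideal J "mpoly_ring W" by fact
  show ?thesis
  proof (rule ideal_mpoly_ringI)
    show "0 \<in> {p \<in> carrier (mpoly_ring V). subst g p \<in> J}"
      using J.zero_closed by (simp add: zero_in_carrier)
  next
    fix p q :: "('v, 'a) mpol"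
    assume "p \<in> {p \<in> carrier (mpoly_ring V). subst g p \<in> J}"
      "q \<in> {p \<in> carrier (mpoly_ring V). subst g p \<in> J}"
    then show "p + q \<in> {p \<in> carrier (mpoly_ring V). subst g p \<in> J}"
      using J.a_closed[of "subst g p" "subst g q"] by (simp add: add_in_carrier subst_add)
  next
    fix p q :: "('v, 'a) mpol"
    assume p: "p \<in> {p \<in> carrier (mpoly_ring V). subst g p \<in> J}"
      and q: "q \<in> carrier (mpoly_ring V)"
    show "q * p \<in> {p \<in> carrier (mpoly_ring V). subst g p \<in> J}"
      using p q J.I_l_closed[OF _ subst_in_carrier[OF q assms(2)], of "subst g p"]
      by (simp add: mpoly_ring_mult_closed subst_mult)
  qed blast
qed

text \<open>Adding \<open>F\<close> to an ideal amounts to applying \<open>h\<close>: modulo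
  \<open>F\<close> every polynomial agrees with its image, and \<open>h\<close> kills
  \<open>F\<close>. The former extends from variables to all polynomials by induction.\<close>

lemma mem_ideal_union_iff_subst:
  fixes F G :: "('v, 'a::field) mpol set" and \<rho> :: "'v \<Rightarrow> 'v"
  defines "h \<equiv> subst (\<lambda>v. var (\<rho> v)) :: ('v, 'a) mpol \<Rightarrow> ('v, 'a) mpol"
  assumes \<rho>: "\<And>v. v \<in> V \<Longrightarrow> \<rho> v \<in> V"
    and F: "F \<subseteq> carrier (mpoly_ring V)" and F0: "\<And>f. f \<in> F \<Longrightarrow> h f = 0"
    and diff: "\<And>v. v \<in> V \<Longrightarrow> var v - var (\<rho> v) \<in> Idl\<^bsub>mpoly_ring V\<^esub> F"
    and G: "G \<subseteq> carrier (mpoly_ring V)" and a: "a \<in> carrier (mpoly_ring V)"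
  shows "a \<in> Idl\<^bsub>mpoly_ring V\<^esub> (Idl\<^bsub>mpoly_ring V\<^esub> G \<union> F) \<longleftrightarrow> h a \<in> Idl\<^bsub>mpoly_ring V\<^esub> (h ` G)"
proof -
  let ?R = "mpoly_ring V :: ('v, 'a) mpol ring"
  interpret R: cring ?R by (rule cring_mpoly_ring)
  have hc: "h p \<in> carrier ?R" if "p \<in> carrier ?R" for p
    unfolding h_def by (rule subst_in_carrier[OF that]) (simp add: var_in_carrier \<rho>)
  interpret IG: ideal "Idl\<^bsub>?R\<^esub> G" ?R by (rule R.genideal_ideal[OF G])
  interpret IF: ideal "Idl\<^bsub>?R\<^esub> F" ?R by (rule R.genideal_ideal[OF F])
  have GF: "Idl\<^bsub>?R\<^esub> G \<union> F \<subseteq> carrier ?R" using IG.a_subset F by auto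
  interpret I: ideal "Idl\<^bsub>?R\<^esub> (Idl\<^bsub>?R\<^esub> G \<union> F)" ?R by (rule R.genideal_ideal[OF GF])
  have hG: "h ` G \<subseteq> carrier ?R" using G hc by auto
  interpret J: ideal "Idl\<^bsub>?R\<^esub> (h ` G)" ?R by (rule R.genideal_ideal[OF hG])
  have FI: "Idl\<^bsub>?R\<^esub> F \<subseteq> Idl\<^bsub>?R\<^esub> (Idl\<^bsub>?R\<^esub> G \<union> F)"
    using R.genideal_self[OF GF] by (intro R.genideal_minimal[OF I.is_ideal]) auto
  have GI: "G \<subseteq> Idl\<^bsub>?R\<^esub> (Idl\<^bsub>?R\<^esub> G \<union> F)"
    using R.genideal_self[OF GF] R.genideal_self[OF G] by auto
  have dif: "p - h p \<in> Idl\<^bsub>?R\<^esub> F" if "p \<in> carrier ?R" for p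
    using that
  proof (induction p rule: mpoly_carrier_induct)
    case (const c)
    then show ?case using IF.zero_closed by (simp add: h_def)
  next
    case (var v)
    then show ?case using diff by (simp add: h_def)
  next
    case (add p q)
    have "(p - h p) + (q - h q) \<in> Idl\<^bsub>?R\<^esub> F"
      using IF.a_closed add.IH by simp
    then show ?case by (simp add: h_def subst_add algebra_simps)
  next
    case (mult p q)
    have "q * (p - h p) + h p * (q - h q) \<in> Idl\<^bsub>?R\<^esub> F"
      using IF.a_closed IF.I_l_closed mult hc by simp
    then show ?case by (simp add: h_def subst_mult algebra_simps)
  qed
  show ?thesis
  proof
    assume "a \<in> Idl\<^bsub>?R\<^esub> (Idl\<^bsub>?R\<^esub> G \<union> F)"
    moreover have N: "ideal {p \<in> carrier ?R. h p \<in> Idl\<^bsub>?R\<^esub> (h ` G)} ?R" (is "ideal ?N _")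
      unfolding h_def
      by (rule ideal_mpoly_vimage) (use J.is_ideal \<rho> in \<open>auto simp: h_def var_in_carrier\<close>)
    moreover have "G \<subseteq> ?N"
      using R.genideal_self[OF hG] G by auto
    then have "Idl\<^bsub>?R\<^esub> G \<subseteq> ?N"
      by (rule R.genideal_minimal[OF N])
    moreover have "F \<subseteq> ?N"
      using F F0 J.zero_closed by auto
    ultimately show "h a \<in> Idl\<^bsub>?R\<^esub> (h ` G)"
      using R.genideal_minimal[OF N, of "Idl\<^bsub>?R\<^esub> G \<union> F"] by blast
  next
    assume ha: "h a \<in> Idl\<^bsub>?R\<^esub> (h ` G)"
    have minus: "p - q \<in> Idl\<^bsub>?R\<^esub> (Idl\<^bsub>?R\<^esub> G \<union> F)"
      if "p \<in> Idl\<^bsub>?R\<^esub> (Idl\<^bsub>?R\<^esub> G \<union> F)" "q \<in> Idl\<^bsub>?R\<^esub> (Idl\<^bsub>?R\<^esub> G \<union> F)" for p q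
      using I.a_closed[OF that(1) ideal_mpoly_ring_uminus[OF I.is_ideal that(2)]] by simp
    have "h g \<in> Idl\<^bsub>?R\<^esub> (Idl\<^bsub>?R\<^esub> G \<union> F)" if "g \<in> G" for g
      using minus[of g "g - h g"] GI FI dif[of g] that G by auto
    then have "Idl\<^bsub>?R\<^esub> (h ` G) \<subseteq> Idl\<^bsub>?R\<^esub> (Idl\<^bsub>?R\<^esub> G \<union> F)"
      by (intro R.genideal_minimal[OF I.is_ideal]) auto
    then have "(a - h a) + h a \<in> Idl\<^bsub>?R\<^esub> (Idl\<^bsub>?R\<^esub> G \<union> F)"
      using I.a_closed[of "a - h a" "h a"] ha dif[OF a] FI by auto
    then show "a \<in> Idl\<^bsub>?R\<^esub> (Idl\<^bsub>?R\<^esub> G \<union> F)" by simp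
  qed
qed

subsection \<open>The exchange condition\<close>

text \<open>\<open>\<phi> A t\<close> is the upper index of \<open>x\<^sub>t\<close> in the generator \<open>m\<^sub>A\<close>; indices at variables in \<open>L\<close> are
  ignored.\<close>

definition exchange_off ::
  "nat set \<Rightarrow> nat set set \<Rightarrow> (nat set \<Rightarrow> nat \<Rightarrow> nat) \<Rightarrow> nat \<Rightarrow> bool" where
  "exchange_off L \<Gamma> \<phi> i \<longleftrightarrow> (\<forall>A\<in>\<Gamma>. \<forall>B\<in>\<Gamma>. i \<in> A \<longrightarrow> i \<in> B \<longrightarrow> \<phi> A i \<noteq> \<phi> B i \<longrightarrow>
     (\<exists>C\<in>\<Gamma>. C \<subseteq> A \<union> B - {i} \<and>
       (\<forall>t\<in>C - L. t \<in> A \<and> \<phi> C t = \<phi> A t \<or> t \<in> B \<and> \<phi> C t = \<phi> B t)))"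

lemma exchange_offE:
  assumes "exchange_off L \<Gamma> \<phi> i" "A \<in> \<Gamma>" "B \<in> \<Gamma>" "i \<in> A" "i \<in> B" "\<phi> A i \<noteq> \<phi> B i"
  obtains C where "C \<in> \<Gamma>" "C \<subseteq> A \<union> B" "i \<notin> C"
    "\<And>t. t \<in> C \<Longrightarrow> t \<notin> L \<Longrightarrow> t \<in> A \<and> \<phi> C t = \<phi> A t \<or> t \<in> B \<and> \<phi> C t = \<phi> B t"
proof -
  obtain C where "C \<in> \<Gamma>" "C \<subseteq> A \<union> B - {i}"
    "\<forall>t\<in>C - L. t \<in> A \<and> \<phi> C t = \<phi> A t \<or> t \<in> B \<and> \<phi> C t = \<phi> B t"
    using assms(1)[unfolded exchange_off_def, rule_format, OF assms(2-6)] by (elim bexE conjE)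
  then show ?thesis using that[of C] by auto
qed

text \<open>If the set \<open>C\<close> exchanged for \<open>A\<close> and \<open>B\<close> at \<open>i\<close> has a wrong index at \<open>l\<close>, exchange \<open>A\<close> with \<open>C\<close>
  and \<open>B\<close> with \<open>C\<close> at \<open>l\<close>. Neither result contains \<open>l\<close>, and exchanging the two at \<open>i\<close> gives a
  set that avoids \<open>l\<close> as well.\<close>

lemma exchange_off_remove:
  assumes i: "exchange_off (insert l L) \<Gamma> \<phi> i" and l: "exchange_off {} \<Gamma> \<phi> l"
  shows "exchange_off L \<Gamma> \<phi> i"
  unfolding exchange_off_def
proof (intro ballI impI)
  fix A B assume A: "A \<in> \<Gamma>" "i \<in> A" and B: "B \<in> \<Gamma>" "i \<in> B" and AB: "\<phi> A i \<noteq> \<phi> B i"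
  let ?ok = "\<lambda>C t. t \<in> A \<and> \<phi> C t = \<phi> A t \<or> t \<in> B \<and> \<phi> C t = \<phi> B t"
  obtain C where C: "C \<in> \<Gamma>" "C \<subseteq> A \<union> B" "i \<notin> C"
    and okC: "\<And>t. t \<in> C \<Longrightarrow> t \<notin> insert l L \<Longrightarrow> ?ok C t"
    using exchange_offE[OF i A(1) B(1) A(2) B(2) AB] by blast
  show "\<exists>C\<in>\<Gamma>. C \<subseteq> A \<union> B - {i} \<and> (\<forall>t\<in>C - L. ?ok C t)"
  proof (cases "l \<in> C \<and> \<not> ?ok C l")
    case False
    then show ?thesis using C okC by blast
  next
    case bad: True
    have avoid: "\<exists>D\<in>\<Gamma>. D \<subseteq> A \<union> B \<and> l \<notin> D \<and> (\<forall>t\<in>D - insert l L. ?ok D t) \<and>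
        (i \<in> D \<longrightarrow> \<phi> D i = \<phi> X i)" if X: "X = A \<or> X = B" for X
    proof (cases "l \<in> X")
      case False
      \<comment> \<open>A set that already misses \<open>l\<close> needs no exchange and keeps all
        its indices.\<close>
      then show ?thesis using X A B by auto
    next
      case True
      have "\<phi> X l \<noteq> \<phi> C l" using bad X True by auto
      then obtain D where D: "D \<in> \<Gamma>" "D \<subseteq> X \<union> C" "l \<notin> D"
        and ok: "\<And>t. t \<in> D \<Longrightarrow> t \<in> X \<and> \<phi> D t = \<phi> X t \<or> t \<in> C \<and> \<phi> D t = \<phi> C t"
        using exchange_offE[OF l, of X C] X A(1) B(1) C(1) True bad by (metis empty_iff)
      show ?thesis
      proof (intro bexI[of _ D] conjI ballI impI)
        show "D \<subseteq> A \<union> B" using D X C by blast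
        show "?ok D t" if "t \<in> D - insert l L" for t
          using ok[of t] okC[of t] that X by auto
        \<comment> \<open>\<open>D\<close> draws its indices from \<open>X\<close> and
          \<open>C\<close>, and \<open>C\<close> misses \<open>i\<close>; so the index at
          \<open>i\<close> can only come from \<open>X\<close>.\<close>
        show "\<phi> D i = \<phi> X i" if "i \<in> D" using ok[OF that] C(3) by simp
      qed (use D in auto)
    qed
    obtain D where D: "D \<in> \<Gamma>" "D \<subseteq> A \<union> B" "l \<notin> D"
      "\<And>t. t \<in> D \<Longrightarrow> t \<notin> insert l L \<Longrightarrow> ?ok D t" "i \<in> D \<Longrightarrow> \<phi> D i = \<phi> A i"
      using avoid[of A] by auto
    obtain E where E: "E \<in> \<Gamma>" "E \<subseteq> A \<union> B" "l \<notin> E"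
      "\<And>t. t \<in> E \<Longrightarrow> t \<notin> insert l L \<Longrightarrow> ?ok E t" "i \<in> E \<Longrightarrow> \<phi> E i = \<phi> B i"
      using avoid[of B] by auto
    consider "i \<notin> D" | "i \<notin> E" | "i \<in> D" "i \<in> E" by blast
    then show ?thesis
    proof cases
      case 1
      then show ?thesis using D by (intro bexI[of _ D]) auto
    next
      case 2
      then show ?thesis using E by (intro bexI[of _ E]) auto
    next
      case 3
      \<comment> \<open>\<open>D\<close> and \<open>E\<close> inherit the indices of
        \<open>A\<close> and \<open>B\<close> at \<open>i\<close>, so they still differ there and
        the hypothesis for \<open>i\<close> applies to them.\<close>
      then have "\<phi> D i \<noteq> \<phi> E i" using D(5) E(5) AB by simp
      then obtain G where G: "G \<in> \<Gamma>" "G \<subseteq> D \<union> E" "i \<notin> G"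
        and okG: "\<And>t. t \<in> G \<Longrightarrow> t \<notin> insert l L \<Longrightarrow>
          t \<in> D \<and> \<phi> G t = \<phi> D t \<or> t \<in> E \<and> \<phi> G t = \<phi> E t"
        using exchange_offE[OF i D(1) E(1) 3] by blast
      show ?thesis
      proof (intro bexI[of _ G] conjI ballI)
        show "G \<subseteq> A \<union> B - {i}" using G D E by blast
        show "?ok G t" if t: "t \<in> G - L" for t
        proof -
          have "t \<noteq> l" using t G(2) D(3) E(3) by blast
          then show ?thesis using okG[of t] D(4)[of t] E(4)[of t] t by auto
        qed
      qed (use G in auto)
    qed
  qed
qed

text \<open>Strong induction on \<open>i\<close>: the full condition is then known at every
  \<open>l < i\<close>, so these elements can be struck from the ignored set, the largest
  first.\<close>

lemma exchange_off_lessThan: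
  assumes "\<And>i. exchange_off {..<i} \<Gamma> \<phi> i"
  shows "exchange_off {} \<Gamma> \<phi> i"
proof (induction i rule: less_induct)
  case (less i)
  \<comment> \<open>\<open>m\<close> counts the struck elements. At \<open>m = i\<close> nothing is
    left to ignore, and beyond that truncated subtraction changes nothing.\<close>
  have "exchange_off {..<i - m} \<Gamma> \<phi> i" for m
  proof (induction m)
    case 0
    show ?case using assms by simp
  next
    case (Suc m)
    show ?case
    proof (cases "m < i")
      case True
      then have "insert (i - Suc m) {..<i - Suc m} = {..<i - m}" by auto
      then have "exchange_off (insert (i - Suc m) {..<i - Suc m}) \<Gamma> \<phi> i"
        using Suc.IH by metis
      then show ?thesis
        by (rule exchange_off_remove) (rule less.IH, use True in simp)
    next
      case False
      then show ?thesis using Suc.IH by simp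
    qed
  qed
  from this[of i] show ?case by (metis diff_self_eq_0 lessThan_0)
qed

lemma exchange_off_mono: "exchange_off L \<Gamma> \<phi> i \<Longrightarrow> L \<subseteq> L' \<Longrightarrow> exchange_off L' \<Gamma> \<phi> i"
proof -
  assume ex: "exchange_off L \<Gamma> \<phi> i" and L: "L \<subseteq> L'"
  show "exchange_off L' \<Gamma> \<phi> i"
    unfolding exchange_off_def
  proof (intro ballI impI)
    fix A B assume "A \<in> \<Gamma>" "B \<in> \<Gamma>" "i \<in> A" "i \<in> B" "\<phi> A i \<noteq> \<phi> B i"
    from exchange_offE[OF ex this] obtain C where C: "C \<in> \<Gamma>" "C \<subseteq> A \<union> B" "i \<notin> C"
      and ok: "\<And>t. t \<in> C \<Longrightarrow> t \<notin> L \<Longrightarrow>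
        t \<in> A \<and> \<phi> C t = \<phi> A t \<or> t \<in> B \<and> \<phi> C t = \<phi> B t"
      by metis
    show "\<exists>C\<in>\<Gamma>. C \<subseteq> A \<union> B - {i} \<and>
        (\<forall>t\<in>C - L'. t \<in> A \<and> \<phi> C t = \<phi> A t \<or> t \<in> B \<and> \<phi> C t = \<phi> B t)"
    proof (intro bexI[of _ C] conjI ballI)
      show "C \<subseteq> A \<union> B - {i}" using C by blast
      show "t \<in> A \<and> \<phi> C t = \<phi> A t \<or> t \<in> B \<and> \<phi> C t = \<phi> B t" if "t \<in> C - L'" for t
        using ok[of t] that L by blast
    qed (rule C)
  qed
qed

subsection \<open>Differences of variables modulo monomial ideals\<close>

text \<open>Among the monomials of \<open>p\<close> outside the ideal take an \<open>m\<close> with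
  largest exponent at \<open>u\<close>. If \<open>u m\<close> were outside, its coefficient would
  have to cancel against some \<open>v m'\<close> with \<open>m'\<close> also outside and of larger
  \<open>u\<close>-exponent. So \<open>u m\<close> lies inside, and squarefreeness in
  \<open>u\<close> shows that \<open>u\<close> does not divide \<open>m\<close>. Then the
  coefficient of \<open>v m\<close> cannot cancel, so \<open>v m\<close> lies inside as well, and
  \<open>sep\<close> puts \<open>m\<close> into the ideal.\<close>

lemma var_diff_regular_mod_monomial_ideal:
  fixes p :: "('v, 'a::field) mpol"
  assumes M: "\<And>g. g \<in> M \<Longrightarrow> Poly_Mapping.keys g \<subseteq> V"
    and sq: "\<And>g. g \<in> M \<Longrightarrow> Poly_Mapping.lookup g u \<le> 1" and uv: "u \<noteq> v"
    and sep: "\<And>m g g'. g \<in> M \<Longrightarrow> g' \<in> M \<Longrightarrow> exp_le g (Poly_Mapping.single u 1 + m) \<Longrightarrow>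
      exp_le g' (Poly_Mapping.single v 1 + m) \<Longrightarrow> \<exists>g\<in>M. exp_le g m"
    and p: "p \<in> carrier (mpoly_ring V)"
    and mem: "(var u - var v) * p \<in> Idl\<^bsub>mpoly_ring V\<^esub> (monomial ` M)"
  shows "p \<in> Idl\<^bsub>mpoly_ring V\<^esub> (monomial ` M)"
proof -
  let ?U = "\<lambda>m. \<exists>g\<in>M. exp_le g m"
  let ?q = "(var u - var v) * p"
  let ?u = "Poly_Mapping.single u (1::nat)" and ?v = "Poly_Mapping.single v (1::nat)"
  have mem_iff: "q \<in> Idl\<^bsub>mpoly_ring V\<^esub> (monomial ` M) \<longleftrightarrow>
      q \<in> carrier (mpoly_ring V) \<and> (\<forall>m\<in>Poly_Mapping.keys q. ?U m)" for q :: "('v, 'a) mpol"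
    by (rule mem_monomial_ideal_iff) (rule M)
  have U_q: "?U m" if "Poly_Mapping.lookup ?q m \<noteq> 0" for m
    using mem that by (simp add: mem_iff in_keys_iff)
  have q: "Poly_Mapping.lookup ?q k =
      Poly_Mapping.lookup (Poly_Mapping.single ?u 1 * p) k - Poly_Mapping.lookup (Poly_Mapping.single ?v 1 * p) k" for k
    by (simp add: var_def monomial_def left_diff_distrib lookup_minus)
  have U_add: "?U (a + m)" if "?U m" for a m
    using that exp_le_trans exp_le_add by blast
  let ?bad = "{m \<in> Poly_Mapping.keys p. \<not> ?U m}"
  have "?bad = {}"
  proof (rule ccontr)
    assume ne: "?bad \<noteq> {}"
    let ?e = "(\<lambda>m. Poly_Mapping.lookup m u) ` ?bad"
    have fin: "finite ?e" by simp
    have "Max ?e \<in> ?e" using ne by (intro Max_in fin) blast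
    then obtain m where m: "m \<in> ?bad" and "Max ?e = Poly_Mapping.lookup m u" by blast
    then have max: "Poly_Mapping.lookup m' u \<le> Poly_Mapping.lookup m u" if "m' \<in> ?bad" for m'
      using Max_ge[OF fin] that by fastforce
    have pm: "Poly_Mapping.lookup p m \<noteq> 0" using m by (simp add: in_keys_iff)
    have Uu: "?U (?u + m)"
    proof (rule ccontr)
      assume no: "\<not> ?U (?u + m)"
      then have "Poly_Mapping.lookup ?q (?u + m) = 0" using U_q by blast
      then have v0: "Poly_Mapping.lookup (Poly_Mapping.single ?v 1 * p) (?u + m) \<noteq> 0"
        using pm by (simp add: q lookup_single_mult_add)
      then have "exp_le ?v (?u + m)" using lookup_single_mult_eq_0 by blast
      define m' where "m' = ?u + m - ?v"
      have eq: "?u + m = ?v + m'"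
        using exp_le_imp_eq_add[OF \<open>exp_le ?v (?u + m)\<close>] by (simp add: m'_def add.commute)
      have "Poly_Mapping.lookup p m' \<noteq> 0"
        using v0 unfolding eq by (simp add: lookup_single_mult_add)
      moreover have "\<not> ?U m'" using no U_add unfolding eq by blast
      ultimately have "m' \<in> ?bad" by (simp add: in_keys_iff)
      moreover have "Poly_Mapping.lookup m' u = Suc (Poly_Mapping.lookup m u)"
        using uv by (simp add: m'_def lookup_minus lookup_add lookup_single when_def)
      ultimately show False using max by fastforce
    qed
    then obtain g where g: "g \<in> M" "exp_le g (?u + m)" by blast
    have "\<not> exp_le g m" using m g by blast
    then obtain w where w: "Poly_Mapping.lookup m w < Poly_Mapping.lookup g w"
      by (auto simp: exp_le_def not_le)
    have "w = u"
      using w exp_leD[OF g(2), of w] by (cases "w = u") (auto simp: lookup_add lookup_single when_def)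
    then have mu: "Poly_Mapping.lookup m u = 0" using w sq[OF g(1)] by simp
    have "\<not> exp_le ?u (?v + m)"
      using exp_leD[of ?u "?v + m" u] mu uv by (auto simp: lookup_add lookup_single when_def)
    then have "Poly_Mapping.lookup ?q (?v + m) = - Poly_Mapping.lookup p m"
      by (simp add: q lookup_single_mult_eq_0 lookup_single_mult_add)
    then have "?U (?v + m)" using pm U_q[of "?v + m"] by simp
    then have "?U m" using sep g by blast
    then show False using m by blast
  qed
  then show ?thesis
    using p by (auto simp: mem_iff)
qed

text \<open>As \<open>fst (f t) = t\<close>, distinct \<open>t\<close> give distinct variables. This
  is why the generators stay squarefree under every identification.\<close>

lemma lookup_sum_single:
  fixes f :: "'b \<Rightarrow> 'b \<times> 'c"
  assumes "finite A" "\<And>t. t \<in> A \<Longrightarrow> fst (f t) = t"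
  shows "Poly_Mapping.lookup (\<Sum>t\<in>A. Poly_Mapping.single (f t) (1::nat)) x =
    (if fst x \<in> A \<and> f (fst x) = x then 1 else 0)"
proof -
  have "Poly_Mapping.lookup (\<Sum>t\<in>A. Poly_Mapping.single (f t) (1::nat)) x =
      (\<Sum>t\<in>A. if t = fst x then (if f (fst x) = x then 1 else 0) else 0)"
    unfolding lookup_sum
    by (rule sum.cong) (use assms in \<open>auto simp: lookup_single when_def\<close>)
  then show ?thesis using assms by simp
qed

section \<open>The order of the sequence and its initial segments\<close>

lemma set_take_sorted_wrt:
  assumes "sorted_wrt R xs" "\<And>x y. R x y \<Longrightarrow> \<not> R y x" "k < length xs"
  shows "set (take k xs) = {x \<in> set xs. R x (xs ! k)}"
proof (intro equalityI subsetI)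
  fix x assume "x \<in> set (take k xs)"
  then obtain l where "l < k" "x = xs ! l" using assms(3) by (auto simp: in_set_conv_nth)
  then show "x \<in> {x \<in> set xs. R x (xs ! k)}"
    using sorted_wrt_nth_less[OF assms(1), of l k] assms(3) by auto
next
  fix x assume x: "x \<in> {x \<in> set xs. R x (xs ! k)}"
  then obtain l where l: "l < length xs" "x = xs ! l" by (auto simp: in_set_conv_nth)
  have "l < k"
  proof (rule ccontr)
    assume "\<not> l < k"
    then consider "l = k" | "k < l" by linarith
    then show False
      using x l assms(2) sorted_wrt_nth_less[OF assms(1), of k l] by cases blast+
  qed
  then show "x \<in> set (take k xs)"
    using l assms(3) by (auto simp: in_set_conv_nth)
qed

text \<open>The pairs are listed apart from the polynomials because they carry an order, by which an
  initial segment of the sequence can be described as a set.\<close>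

definition pol_index :: "nat \<Rightarrow> (nat \<Rightarrow> nat) \<Rightarrow> (nat \<times> nat) list" where
  "pol_index n r = concat (map (\<lambda>i. map (Pair i) [2..<Suc (r i)]) [1..<Suc n])"

definition lex_less :: "nat \<times> nat \<Rightarrow> nat \<times> nat \<Rightarrow> bool" where
  "lex_less x y \<longleftrightarrow> fst x < fst y \<or> fst x = fst y \<and> snd x < snd y"

lemma pol_sequence_eq:
  "pol_sequence n r = map (\<lambda>(i, j). var (i, 1) - var (i, j)) (pol_index n r)"
  by (simp add: pol_sequence_def pol_index_def map_concat comp_def)

lemma set_pol_index: "set (pol_index n r) = (SIGMA i:{1..n}. {2..r i})"
proof -
  have "{1..<Suc n} = {1..n}" "{2..<Suc (r i)} = {2..r i}" for i by auto
  then show ?thesis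
    unfolding pol_index_def by (auto simp del: upt_Suc atLeastLessThan_iff)
qed

lemma sorted_pol_index: "sorted_wrt lex_less (pol_index n r)"
proof (induction n)
  case 0
  show ?case by (simp add: pol_index_def)
next
  case (Suc n)
  have "pol_index (Suc n) r = pol_index n r @ map (Pair (Suc n)) [2..<Suc (r (Suc n))]"
    by (simp add: pol_index_def)
  moreover have "sorted_wrt lex_less (map (Pair (Suc n)) [2..<Suc (r (Suc n))])"
    unfolding sorted_wrt_map by (simp add: lex_less_def del: upt_Suc)
  moreover have "lex_less x y"
    if "x \<in> set (pol_index n r)" "y \<in> set (map (Pair (Suc n)) [2..<Suc (r (Suc n))])" for x y
    using that by (auto simp: set_pol_index lex_less_def simp del: upt_Suc)
  ultimately show ?case
    using Suc.IH by (simp add: sorted_wrt_append del: upt_Suc)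
qed

text \<open>The identifications already made when \<open>x\<^sub>i\<^sup>(\<^sup>1\<^sup>) - x\<^sub>i\<^sup>(\<^sup>j\<^sup>)\<close> is reached.\<close>

definition collapse :: "nat \<Rightarrow> nat \<Rightarrow> nat \<times> nat \<Rightarrow> nat \<times> nat" where
  "collapse i j x = (if lex_less x (i, j) then (fst x, 1) else x)"

lemma fst_collapse [simp]: "fst (collapse i j x) = fst x"
  by (simp add: collapse_def)

lemma collapse_collapse: "2 \<le> j \<Longrightarrow> collapse i j (collapse i j x) = collapse i j x"
  by (auto simp: collapse_def lex_less_def)

subsection \<open>Partitionings\<close>

text \<open>The pair \<open>x\<close> marks a place in the order and need not occur in the sequence:
  \<open>(Suc n, 0)\<close> lies beyond every entry and yields all of them.\<close>

definition pol_differences :: "nat \<Rightarrow> (nat \<Rightarrow> nat) \<Rightarrow> nat \<times> nat \<Rightarrow> (nat \<times> nat, 'a::field) mpol set" where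
  "pol_differences n r x =
     (\<lambda>(i, j). var (i, 1) - var (i, j)) ` {y \<in> SIGMA i:{1..n}. {2..r i}. lex_less y x}"

lemma set_take_pol_sequence:
  assumes "k < length (pol_index n r)"
  shows "set (take k (pol_sequence n r)) = pol_differences n r (pol_index n r ! k)"
proof -
  have "set (take k (pol_index n r)) = {x \<in> set (pol_index n r). lex_less x (pol_index n r ! k)}"
    by (rule set_take_sorted_wrt[OF sorted_pol_index _ assms]) (simp add: lex_less_def, arith)
  then show ?thesis
    by (simp only: pol_sequence_eq pol_differences_def take_map set_pol_index set_map)
qed

lemma set_pol_sequence: "set (pol_sequence n r) = pol_differences n r (Suc n, 0)"
proof -
  have "{y \<in> SIGMA i:{1..n}. {2..r i}. lex_less y (Suc n, 0)} = (SIGMA i:{1..n}. {2..r i})"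
    by (auto simp: lex_less_def)
  then show ?thesis
    by (simp only: pol_differences_def pol_sequence_eq set_map set_pol_index)
qed

locale polarization_partition =
  fixes n d :: nat and r :: "nat \<Rightarrow> nat" and P :: "nat \<Rightarrow> nat \<Rightarrow> nat set set"
  assumes d_pos: "1 \<le> d" and d_le: "d \<le> n" and partitioning: "partitioning n d r P"
begin

definition idx :: "nat set \<Rightarrow> nat \<Rightarrow> nat" where
  "idx \<sigma> t = part_index r P t (\<sigma> - {t})"

text \<open>Exponent vector of the generator for \<open>\<sigma>\<close> in the partial quotient in
  which step \<open>(i, j)\<close> is about to be taken.\<close>

definition gen :: "nat \<Rightarrow> nat \<Rightarrow> nat set \<Rightarrow> (nat \<times> nat \<Rightarrow>\<^sub>0 nat)" where
  "gen i j \<sigma> = (\<Sum>t\<in>\<sigma>. Poly_Mapping.single (collapse i j (t, idx \<sigma> t)) 1)"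

definition identify :: "nat \<Rightarrow> nat \<Rightarrow> (nat \<times> nat, 'a::field) mpol \<Rightarrow> (nat \<times> nat, 'a) mpol" where
  "identify i j = subst (\<lambda>x. var (collapse i j x))"

lemma GammaD:
  assumes "\<sigma> \<in> Gamma n d"
  shows "\<sigma> \<subseteq> {1..n}" "finite \<sigma>" "card \<sigma> = d"
  using assms finite_subset[of \<sigma> "{1..n}"] by (auto simp: Gamma_def)

lemma Gamma_remove:
  assumes "\<sigma> \<in> Gamma n d" "t \<in> \<sigma>"
  shows "\<sigma> - {t} \<in> Sigma_set n d t"
  using GammaD[OF assms(1)] assms(2) by (auto simp: Sigma_set_def Gamma_def)

lemma Sigma_insert:
  assumes "\<sigma> \<in> Sigma_set n d t" "t \<in> {1..n}"
  shows "insert t \<sigma> \<in> Gamma n d"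
proof -
  have \<sigma>: "\<sigma> \<subseteq> {1..n}" "card \<sigma> = d - 1" "t \<notin> \<sigma>"
    using assms(1) by (simp_all add: Sigma_set_def Gamma_def)
  then have "finite \<sigma>" by (meson finite_atLeastAtMost finite_subset)
  then show ?thesis using \<sigma> d_pos assms(2) by (simp add: Gamma_def)
qed

lemma partD:
  assumes "t \<in> {1..n}"
  shows "disjoint_family_on (P t) {1..r t}" "(\<Union>s\<in>{1..r t}. P t s) = Sigma_set n d t"
  using bspec[OF partitioning[unfolded partitioning_def] assms] by simp_all

lemma part_subset: "t \<in> {1..n} \<Longrightarrow> s \<in> {1..r t} \<Longrightarrow> P t s \<subseteq> Sigma_set n d t"
  using partD(2)[of t] by blast

lemma part_unique:
  assumes "t \<in> {1..n}" "s \<in> {1..r t}" "s' \<in> {1..r t}" "\<rho> \<in> P t s" "\<rho> \<in> P t s'"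
  shows "s = s'"
  using disjoint_family_onD[OF partD(1)[OF assms(1)] assms(2,3)] assms(4,5) by blast

lemma part_index:
  assumes "t \<in> {1..n}" "\<rho> \<in> Sigma_set n d t"
  shows "part_index r P t \<rho> \<in> {1..r t} \<and> \<rho> \<in> P t (part_index r P t \<rho>)"
proof -
  obtain s where s: "s \<in> {1..r t}" "\<rho> \<in> P t s"
    using partD(2)[OF assms(1)] assms(2) by blast
  have "\<exists>!j. j \<in> {1..r t} \<and> \<rho> \<in> P t j"
  proof (rule ex1I[of _ s])
    fix j assume "j \<in> {1..r t} \<and> \<rho> \<in> P t j"
    then show "j = s" using part_unique[OF assms(1) _ s(1) _ s(2)] by blast
  qed (use s in simp)
  then show ?thesis unfolding part_index_def by (rule theI')
qed

lemma idx_part: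
  assumes "\<sigma> \<in> Gamma n d" "t \<in> \<sigma>"
  shows "idx \<sigma> t \<in> {1..r t}" "\<sigma> - {t} \<in> P t (idx \<sigma> t)"
  using part_index[OF subsetD[OF GammaD(1)[OF assms(1)] assms(2)] Gamma_remove[OF assms]]
  by (simp_all add: idx_def)

lemmas idx_range = idx_part(1)

lemma mem_part_iff:
  assumes "\<sigma> \<in> Gamma n d" "t \<in> \<sigma>" "s \<in> {1..r t}"
  shows "\<sigma> - {t} \<in> P t s \<longleftrightarrow> s = idx \<sigma> t"
proof
  assume "\<sigma> - {t} \<in> P t s"
  then show "s = idx \<sigma> t"
    using part_unique[OF subsetD[OF GammaD(1)[OF assms(1)] assms(2)] assms(3)] idx_part[OF assms(1,2)]
    by blast
qed (simp add: idx_part[OF assms(1,2)])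

text \<open>Since \<open>d - 1 \<le> n - 1\<close>, some set of size \<open>d - 1\<close> avoids
  \<open>t\<close> and must lie in a part. Hence the variable \<open>(t, 1)\<close>, the target of
  \<open>collapse\<close>, exists.\<close>

lemma parts_pos:
  assumes "t \<in> {1..n}"
  shows "1 \<le> r t"
proof -
  have "card ({1..n} - {t}) = n - 1" using assms by simp
  then obtain \<rho> where "\<rho> \<subseteq> {1..n} - {t}" "card \<rho> = d - 1"
    using obtain_subset_with_card_n[of "d - 1" "{1..n} - {t}"] d_le by (metis diff_le_mono)
  then have "\<rho> \<in> Sigma_set n d t" by (auto simp: Sigma_set_def Gamma_def)
  from part_index[OF assms this] show ?thesis by auto
qed

text \<open>Adding \<open>i\<close> turns a member of \<open>P i j\<close> into a
  \<open>d\<close>-set through \<open>i\<close> whose index there is \<open>j\<close>. A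
  \<open>\<beta>\<close> inside \<open>\<sigma> \<union> \<tau>\<close> misses \<open>i\<close>
  automatically, as both sets do.\<close>

lemma exchange_iff:
  "(\<forall>i\<in>{1..n}. \<forall>j\<in>{1..r i}. \<forall>j'\<in>{1..r i}. j \<noteq> j' \<longrightarrow>
      (\<forall>\<sigma>\<in>P i j. \<forall>\<tau>\<in>P i j'. \<exists>\<beta>. \<beta> \<subseteq> \<sigma> \<union> \<tau> \<and> card \<beta> = d \<and>
         (\<forall>t\<in>\<beta>. \<forall>s\<in>{1..r t}. \<beta> - {t} \<in> P t s \<longrightarrow>
            (\<sigma> \<union> {i}) - {t} \<in> P t s \<or> (\<tau> \<union> {i}) - {t} \<in> P t s))) \<longleftrightarrow>
    (\<forall>i. exchange_off {} (Gamma n d) idx i)" (is "?L \<longleftrightarrow> ?R")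
proof
  assume L: ?L
  show ?R
    unfolding exchange_off_def
  proof (intro allI ballI impI)
    fix i A B
    assume A: "A \<in> Gamma n d" "i \<in> A" and B: "B \<in> Gamma n d" "i \<in> B" and AB: "idx A i \<noteq> idx B i"
    have i: "i \<in> {1..n}" using GammaD(1)[OF A(1)] A(2) by blast
    have PA: "A - {i} \<in> P i (idx A i)" and PB: "B - {i} \<in> P i (idx B i)"
      using idx_part(2)[OF A] idx_part(2)[OF B] .
    have ins: "(A - {i}) \<union> {i} = A" "(B - {i}) \<union> {i} = B" using A B by auto
    obtain C where C: "C \<subseteq> (A - {i}) \<union> (B - {i})" "card C = d"
      and ok: "\<And>t s. t \<in> C \<Longrightarrow> s \<in> {1..r t} \<Longrightarrow> C - {t} \<in> P t s \<Longrightarrow> A - {t} \<in> P t s \<or> B - {t} \<in> P t s"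
      using L[rule_format, OF i idx_range[OF A] idx_range[OF B] AB PA PB] unfolding ins by blast
    have CG: "C \<in> Gamma n d"
      using C GammaD(1)[OF A(1)] GammaD(1)[OF B(1)] by (auto simp: Gamma_def)
    have mem: "t \<in> X \<and> idx C t = idx X t"
      if X: "X \<in> Gamma n d" and t: "t \<in> C" and XP: "X - {t} \<in> P t (idx C t)" for X t
    proof -
      have tn: "t \<in> {1..n}" using t GammaD(1)[OF CG] by blast
      have "X - {t} \<in> Sigma_set n d t"
        using part_subset[OF tn idx_range[OF CG t]] XP by blast
      then have "card (X - {t}) = d - 1" by (simp add: Sigma_set_def Gamma_def)
      \<comment> \<open>The stated condition does not say that \<open>t\<close> lies in the set it
        is compared with. Cardinality forces it: members of a part have \<open>d - 1\<close>
        elements, so deleting \<open>t\<close> from the \<open>d\<close>-set \<open>X\<close> must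
        remove something.\<close>
      then have "t \<in> X" using GammaD[OF X] d_pos by (cases "t \<in> X") auto
      then show ?thesis using mem_part_iff[OF X _ idx_range[OF CG t]] XP by simp
    qed
    show "\<exists>C\<in>Gamma n d. C \<subseteq> A \<union> B - {i} \<and>
        (\<forall>t\<in>C - {}. t \<in> A \<and> idx C t = idx A t \<or> t \<in> B \<and> idx C t = idx B t)"
    proof (intro bexI[of _ C] conjI ballI)
      fix t assume "t \<in> C - {}"
      then have t: "t \<in> C" by simp
      have "C - {t} \<in> P t (idx C t)" by (rule idx_part(2)[OF CG t])
      then show "t \<in> A \<and> idx C t = idx A t \<or> t \<in> B \<and> idx C t = idx B t"
        using ok[OF t idx_range[OF CG t]] mem[OF A(1) t] mem[OF B(1) t] by blast
    qed (use C CG in auto)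
  qed
next
  assume R: ?R
  show ?L
  proof (intro ballI impI)
    fix i j j' \<sigma> \<tau>
    assume i: "i \<in> {1..n}" and j: "j \<in> {1..r i}" "j' \<in> {1..r i}" "j \<noteq> j'"
      and \<sigma>: "\<sigma> \<in> P i j" and \<tau>: "\<tau> \<in> P i j'"
    have S: "\<sigma> \<in> Sigma_set n d i" "\<tau> \<in> Sigma_set n d i"
      using part_subset[OF i] j \<sigma> \<tau> by blast+
    let ?A = "\<sigma> \<union> {i}" and ?B = "\<tau> \<union> {i}"
    have A: "?A \<in> Gamma n d" and B: "?B \<in> Gamma n d" using Sigma_insert[OF _ i] S by auto
    have rem: "?A - {i} = \<sigma>" "?B - {i} = \<tau>" using S by (auto simp: Sigma_set_def)
    have "idx ?A i = j" "idx ?B i = j'"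
      using mem_part_iff[OF A, of i j] mem_part_iff[OF B, of i j'] j \<sigma> \<tau> rem by auto
    then have AB: "idx ?A i \<noteq> idx ?B i" using j by simp
    obtain C where C: "C \<in> Gamma n d" "C \<subseteq> ?A \<union> ?B" "i \<notin> C"
      and ok: "\<And>t. t \<in> C \<Longrightarrow> t \<in> ?A \<and> idx C t = idx ?A t \<or> t \<in> ?B \<and> idx C t = idx ?B t"
      using exchange_offE[OF R[rule_format] A B _ _ AB] by auto
    show "\<exists>\<beta>. \<beta> \<subseteq> \<sigma> \<union> \<tau> \<and> card \<beta> = d \<and>
         (\<forall>t\<in>\<beta>. \<forall>s\<in>{1..r t}. \<beta> - {t} \<in> P t s \<longrightarrow> ?A - {t} \<in> P t s \<or> ?B - {t} \<in> P t s)"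
    proof (intro exI[of _ C] conjI ballI impI)
      fix t s assume t: "t \<in> C" and s: "s \<in> {1..r t}" and "C - {t} \<in> P t s"
      then have "s = idx C t" using mem_part_iff[OF C(1) t s] by simp
      then show "?A - {t} \<in> P t s \<or> ?B - {t} \<in> P t s"
        using ok[OF t] mem_part_iff[OF A _ s] mem_part_iff[OF B _ s] by metis
    qed (use C GammaD in auto)
  qed
qed

section \<open>The ideals of the partial quotients\<close>

lemma collapse_in_pol_vars: "x \<in> pol_vars n r \<Longrightarrow> collapse i j x \<in> pol_vars n r"
  using parts_pos by (auto simp: collapse_def pol_vars_def)

lemma idx_in_pol_vars: "\<sigma> \<in> Gamma n d \<Longrightarrow> t \<in> \<sigma> \<Longrightarrow> (t, idx \<sigma> t) \<in> pol_vars n r"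
  using idx_range GammaD(1) unfolding pol_vars_def by blast

lemma lookup_gen:
  assumes "\<sigma> \<in> Gamma n d"
  shows "Poly_Mapping.lookup (gen i j \<sigma>) x =
    (if fst x \<in> \<sigma> \<and> collapse i j (fst x, idx \<sigma> (fst x)) = x then 1 else 0)"
  unfolding gen_def by (rule lookup_sum_single) (use GammaD[OF assms] in auto)

lemma keys_gen: "\<sigma> \<in> Gamma n d \<Longrightarrow> Poly_Mapping.keys (gen i j \<sigma>) \<subseteq> pol_vars n r"
  using idx_in_pol_vars collapse_in_pol_vars
  by (auto simp: in_keys_iff lookup_gen split: if_splits) metis

lemma mem_gen_ideal_iff:
  "(p :: (nat \<times> nat, 'a::field) mpol) \<in> Idl\<^bsub>mpoly_ring (pol_vars n r)\<^esub> (monomial ` gen i j ` Gamma n d) \<longleftrightarrow>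
    p \<in> carrier (mpoly_ring (pol_vars n r)) \<and>
    (\<forall>m\<in>Poly_Mapping.keys p. \<exists>\<sigma>\<in>Gamma n d. exp_le (gen i j \<sigma>) m)"
  by (subst mem_monomial_ideal_iff) (use keys_gen in auto)

lemma generators_eq:
  "{\<Prod>i\<in>\<sigma>. var (i, part_index r P i (\<sigma> - {i})) | \<sigma>. \<sigma> \<in> Gamma n d} =
    (\<lambda>\<sigma>. \<Prod>t\<in>\<sigma>. var (t, idx \<sigma> t)) ` Gamma n d"
  by (auto simp: idx_def)

lemma generators_in_carrier:
  "(\<lambda>\<sigma>. \<Prod>t\<in>\<sigma>. var (t, idx \<sigma> t)) ` Gamma n d \<subseteq> carrier (mpoly_ring (pol_vars n r))"
  by (auto intro!: prod_in_carrier var_in_carrier idx_in_pol_vars)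

lemma monomial_gen: "monomial (gen i j \<sigma>) = (\<Prod>t\<in>\<sigma>. var (collapse i j (t, idx \<sigma> t)))"
  by (simp add: gen_def monomial_sum var_def)

lemma identify_generators:
  "identify i j ` (\<lambda>\<sigma>. \<Prod>t\<in>\<sigma>. var (t, idx \<sigma> t)) ` Gamma n d = monomial ` gen i j ` Gamma n d"
  unfolding image_image
  by (rule image_cong) (simp_all add: identify_def subst_prod monomial_gen)

text \<open>\<open>collapse i j\<close> is the renaming forced by the differences before
  \<open>(i, j)\<close>: it merges the two variables of each of them, and every variable differs
  from its image by zero or, up to sign, by one of them.\<close>

lemma mem_stage_ideal_iff:
  fixes a :: "(nat \<times> nat, 'a::field) mpol"
  assumes a: "a \<in> carrier (mpoly_ring (pol_vars n r))"
  shows "a \<in> Idl\<^bsub>mpoly_ring (pol_vars n r)\<^esub> (partitioning_ideal n d r P \<union> pol_differences n r (i, j)) \<longleftrightarrow>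
    identify i j a \<in> Idl\<^bsub>mpoly_ring (pol_vars n r)\<^esub> (monomial ` gen i j ` Gamma n d)"
proof -
  let ?V = "pol_vars n r"
  let ?F = "pol_differences n r (i, j) :: (nat \<times> nat, 'a) mpol set"
  interpret R: cring "mpoly_ring ?V :: (nat \<times> nat, 'a) mpol ring" by (rule cring_mpoly_ring)
  have F: "?F \<subseteq> carrier (mpoly_ring ?V)"
    using parts_pos unfolding pol_differences_def
    by (auto intro!: diff_in_carrier var_in_carrier simp: pol_vars_def)
  have F0: "identify i j f = 0" if fF: "f \<in> ?F" for f
  proof -
    obtain s t where f: "f = var (s, 1) - var (s, t)" "2 \<le> t" "lex_less (s, t) (i, j)"
      using fF unfolding pol_differences_def by auto
    then have "lex_less (s, 1) (i, j)" by (auto simp: lex_less_def)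
    then show ?thesis using f by (simp add: identify_def subst_diff collapse_def)
  qed
  have dif: "var x - var (collapse i j x) \<in> Idl\<^bsub>mpoly_ring ?V\<^esub> ?F" if x: "x \<in> ?V" for x
  proof -
    have IF: "ideal (Idl\<^bsub>mpoly_ring ?V\<^esub> ?F) (mpoly_ring ?V)"
      by (rule R.genideal_ideal[OF F])
    have zero: "0 \<in> Idl\<^bsub>mpoly_ring ?V\<^esub> ?F"
      using additive_subgroup.zero_closed[OF ideal.axioms(1)[OF IF]] by simp
    show ?thesis
    proof (cases "lex_less x (i, j) \<and> snd x \<noteq> 1")
      case True
      obtain s t where st: "x = (s, t)" by fastforce
      have "var (s, 1) - var (s, t) \<in> ?F"
        unfolding pol_differences_def
        by (rule image_eqI[of _ _ "(s, t)"]) (use True x st in \<open>auto simp: pol_vars_def\<close>)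
      then have "- (var (s, 1) - var (s, t)) \<in> Idl\<^bsub>mpoly_ring ?V\<^esub> ?F"
        using ideal_mpoly_ring_uminus[OF IF] R.genideal_self[OF F] by blast
      then show ?thesis using True st by (simp add: collapse_def)
    next
      case False
      then have "collapse i j x = x" by (cases x) (auto simp: collapse_def)
      then show ?thesis using zero by simp
    qed
  qed
  have "a \<in> Idl\<^bsub>mpoly_ring ?V\<^esub> (Idl\<^bsub>mpoly_ring ?V\<^esub> ((\<lambda>\<sigma>. \<Prod>t\<in>\<sigma>. var (t, idx \<sigma> t)) ` Gamma n d) \<union> ?F) \<longleftrightarrow>
      identify i j a \<in> Idl\<^bsub>mpoly_ring ?V\<^esub> (identify i j ` (\<lambda>\<sigma>. \<Prod>t\<in>\<sigma>. var (t, idx \<sigma> t)) ` Gamma n d)"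
    unfolding identify_def
    by (rule mem_ideal_union_iff_subst)
      (use collapse_in_pol_vars F F0 dif generators_in_carrier a in \<open>auto simp: identify_def\<close>)
  then show ?thesis
    unfolding partitioning_ideal_def generators_eq identify_generators .
qed

section \<open>One step of the sequence as an exchange condition\<close>

lemma identify_in_carrier:
  "a \<in> carrier (mpoly_ring (pol_vars n r)) \<Longrightarrow> identify i j a \<in> carrier (mpoly_ring (pol_vars n r))"
  unfolding identify_def
  by (rule subst_in_carrier) (auto intro: var_in_carrier collapse_in_pol_vars)

text \<open>If both variables multiply a monomial \<open>m\<close> into the ideal and the two
  generators \<open>A\<close>, \<open>B\<close> responsible do not divide \<open>m\<close>, then
  they use \<open>(i, 1)\<close> and \<open>(i, j)\<close>. The set exchanged for them avoids
  \<open>i\<close>, so each variable of its generator is one of \<open>A\<close> or \<open>B\<close>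
  away from \<open>i\<close>, and these divide \<open>m\<close>.\<close>

lemma exchange_imp_regular_step:
  fixes p :: "(nat \<times> nat, 'a::field) mpol"
  assumes ex: "exchange_off {..<i} (Gamma n d) idx i" and j: "2 \<le> j"
    and p: "p \<in> carrier (mpoly_ring (pol_vars n r))"
    and mem: "(var (i, 1) - var (i, j)) * p \<in> Idl\<^bsub>mpoly_ring (pol_vars n r)\<^esub> (monomial ` gen i j ` Gamma n d)"
  shows "p \<in> Idl\<^bsub>mpoly_ring (pol_vars n r)\<^esub> (monomial ` gen i j ` Gamma n d)"
proof (rule var_diff_regular_mod_monomial_ideal[OF _ _ _ _ p mem])
  show "Poly_Mapping.keys g \<subseteq> pol_vars n r" if "g \<in> gen i j ` Gamma n d" for g
    using that keys_gen by blast
  show "Poly_Mapping.lookup g (i, 1) \<le> 1" if "g \<in> gen i j ` Gamma n d" for g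
    using that by (auto simp: lookup_gen)
  show "(i, 1) \<noteq> (i, j)" using j by simp
next
  fix m g g'
  assume "g \<in> gen i j ` Gamma n d" "g' \<in> gen i j ` Gamma n d"
    and g: "exp_le g (Poly_Mapping.single (i, 1) 1 + m)" and g': "exp_le g' (Poly_Mapping.single (i, j) 1 + m)"
  then obtain A B where A: "A \<in> Gamma n d" "g = gen i j A" and B: "B \<in> Gamma n d" "g' = gen i j B" by blast
  \<comment> \<open>Multiplying \<open>m\<close> by a variable changes the exponent at that variable
    alone.\<close>
  have le: "Poly_Mapping.lookup (gen i j X) x \<le> Poly_Mapping.lookup m x"
    if "(X = A \<and> x \<noteq> (i, 1)) \<or> (X = B \<and> x \<noteq> (i, j))" for X x
    using that exp_leD[OF g, of x] exp_leD[OF g', of x] A B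
    by (auto simp: lookup_add lookup_single when_def split: if_splits)
  show "\<exists>g\<in>gen i j ` Gamma n d. exp_le g m"
  proof (cases "exp_le (gen i j A) m \<or> exp_le (gen i j B) m")
    case True
    then show ?thesis using A B by blast
  next
    case False
    then have nA: "\<not> Poly_Mapping.lookup (gen i j A) (i, 1) \<le> Poly_Mapping.lookup m (i, 1)"
      and nB: "\<not> Poly_Mapping.lookup (gen i j B) (i, j) \<le> Poly_Mapping.lookup m (i, j)"
      using le unfolding exp_le_def by metis+
    then have iA: "i \<in> A" "collapse i j (i, idx A i) = (i, 1)"
      and iB: "i \<in> B" "collapse i j (i, idx B i) = (i, j)"
      using A B by (auto simp: lookup_gen split: if_splits)
    have "idx A i \<noteq> idx B i" using iA(2) iB(2) j by auto
    then obtain C where C: "C \<in> Gamma n d" "C \<subseteq> A \<union> B" "i \<notin> C"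
      and ok: "\<And>t. t \<in> C \<Longrightarrow> t \<notin> {..<i} \<Longrightarrow> t \<in> A \<and> idx C t = idx A t \<or> t \<in> B \<and> idx C t = idx B t"
      using exchange_offE[OF ex A(1) B(1) iA(1) iB(1)] by metis
    have "Poly_Mapping.lookup (gen i j C) x \<le> Poly_Mapping.lookup m x" for x
    proof (cases "fst x \<in> C \<and> collapse i j (fst x, idx C (fst x)) = x")
      case True
      let ?t = "fst x"
      have ti: "?t \<noteq> i" using True C by auto
      have "(?t \<in> A \<and> collapse i j (?t, idx A ?t) = x) \<or> (?t \<in> B \<and> collapse i j (?t, idx B ?t) = x)"
      proof (cases "?t < i")
        case True
        \<comment> \<open>Below \<open>i\<close> the upper index is already lost, so lying in
          \<open>A \<union> B\<close> is enough; these are the indices that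
          \<open>exchange_off {..<i}\<close> ignores.\<close>
        have "collapse i j (?t, s) = (?t, 1)" for s using True by (simp add: collapse_def lex_less_def)
        then show ?thesis using \<open>fst x \<in> C \<and> _\<close> C(2) by (metis UnE subsetD)
      next
        case False
        then show ?thesis using ok[of ?t] True by auto
      qed
      then obtain X where X: "X = A \<or> X = B" "?t \<in> X" "collapse i j (?t, idx X ?t) = x" by blast
      have "Poly_Mapping.lookup (gen i j X) x = 1" using X A B by (auto simp: lookup_gen)
      moreover have "Poly_Mapping.lookup (gen i j X) x \<le> Poly_Mapping.lookup m x"
        by (rule le) (use X ti in auto)
      ultimately show ?thesis using C(1) by (simp add: lookup_gen)
    next
      case False
      then show ?thesis by (simp only: lookup_gen[OF C(1)] if_False le0)
    qed
    then show ?thesis using C(1) by (auto simp: exp_le_def)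
  qed
qed

text \<open>Regularity is applied to one monomial \<open>m\<close> built from \<open>A\<close> and
  \<open>B\<close>, which both variables multiply into the ideal. A generator dividing
  \<open>m\<close> gives the exchanged set; it avoids \<open>i\<close> because \<open>m\<close> has
  no variable with first index \<open>i\<close>.\<close>

lemma regular_step_imp_exchange:
  assumes step: "\<And>j a. j \<in> {2..r i} \<Longrightarrow> a \<in> carrier (mpoly_ring (pol_vars n r)) \<Longrightarrow>
      (var (i, 1) - var (i, j)) * identify i j a \<in> Idl\<^bsub>mpoly_ring (pol_vars n r)\<^esub> (monomial ` gen i j ` Gamma n d) \<Longrightarrow>
      identify i j (a :: (nat \<times> nat, 'a::field) mpol) \<in> Idl\<^bsub>mpoly_ring (pol_vars n r)\<^esub> (monomial ` gen i j ` Gamma n d)"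
  shows "exchange_off {..<i} (Gamma n d) idx i"
proof -
  have main: "\<exists>C\<in>Gamma n d. C \<subseteq> A \<union> B - {i} \<and>
      (\<forall>t\<in>C - {..<i}. t \<in> A \<and> idx C t = idx A t \<or> t \<in> B \<and> idx C t = idx B t)"
    if A: "A \<in> Gamma n d" "i \<in> A" and B: "B \<in> Gamma n d" "i \<in> B" and lt: "idx A i < idx B i" for A B
  proof -
    let ?V = "pol_vars n r"
    let ?J = "\<lambda>j. Idl\<^bsub>mpoly_ring ?V\<^esub> (monomial ` gen i j ` Gamma n d) :: (nat \<times> nat, 'a) mpol set"
    \<comment> \<open>At the step of the larger index the smaller one is already merged into 1,
      while the larger is still a variable of its own. So \<open>A\<close> uses
      \<open>(i, 1)\<close> and \<open>B\<close> uses \<open>(i, j)\<close>.\<close>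
    define j where "j = idx B i"
    have j: "j \<in> {2..r i}" using lt idx_range[OF A] idx_range[OF B] by (auto simp: j_def)
    \<comment> \<open>The variables of the least common multiple of the two collapsed generators,
      each deprived of its variable at \<open>i\<close>. The generators are squarefree, so this set
      determines the multiple.\<close>
    define X where "X = (\<lambda>t. collapse i j (t, idx A t)) ` (A - {i}) \<union> (\<lambda>t. collapse i j (t, idx B t)) ` (B - {i})"
    have fin: "finite X" using GammaD A B by (auto simp: X_def)
    have XV: "X \<subseteq> ?V"
      using A B idx_in_pol_vars collapse_in_pol_vars by (auto simp: X_def)
    have Xfix: "collapse i j x = x" if "x \<in> X" for x
      using that j by (auto simp: X_def collapse_collapse)
    define m where "m = (\<Sum>x\<in>X. Poly_Mapping.single x (1::nat))"
    have lm: "Poly_Mapping.lookup m x = (if x \<in> X then 1 else 0)" for x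
      using fin by (simp add: m_def lookup_sum lookup_single when_def)
    have mc: "(monomial m :: (nat \<times> nat, 'a) mpol) \<in> carrier (mpoly_ring ?V)"
      using XV by (auto simp: monomial_in_carrier in_keys_iff lm split: if_splits)
    \<comment> \<open>The hypothesis speaks only of polynomials \<open>identify i j a\<close>;
      \<open>m\<close> is of this form because its variables are already collapsed.\<close>
    have idm: "identify i j (monomial m :: (nat \<times> nat, 'a) mpol) = monomial m"
      using Xfix unfolding m_def monomial_sum var_def[symmetric]
      by (simp add: identify_def subst_prod)
    have colA: "collapse i j (i, idx A i) = (i, 1)" and colB: "collapse i j (i, idx B i) = (i, j)"
      using lt by (auto simp: collapse_def lex_less_def j_def)
    have le: "exp_le (gen i j Y) (Poly_Mapping.single y 1 + m)"
      if Y: "Y \<in> Gamma n d" "i \<in> Y" and y: "collapse i j (i, idx Y i) = y"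
        and YX: "(\<lambda>t. collapse i j (t, idx Y t)) ` (Y - {i}) \<subseteq> X" for Y y
      unfolding exp_le_def
    proof
      fix x
      show "Poly_Mapping.lookup (gen i j Y) x \<le> Poly_Mapping.lookup (Poly_Mapping.single y 1 + m) x"
      proof (cases "fst x \<in> Y \<and> collapse i j (fst x, idx Y (fst x)) = x")
        case True
        then have "x = y \<or> x \<in> X"
          using y YX by (cases "fst x = i") auto
        then show ?thesis
          by (auto simp: lookup_gen[OF Y(1)] lookup_add lm)
      next
        case False
        then show ?thesis by (simp only: lookup_gen[OF Y(1)] if_False le0)
      qed
    qed
    have u: "exp_le (gen i j A) (Poly_Mapping.single (i, 1) 1 + m)"
      by (rule le[OF A colA]) (simp add: X_def)
    have v: "exp_le (gen i j B) (Poly_Mapping.single (i, j) 1 + m)"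
      by (rule le[OF B colB]) (simp add: X_def)
    have vars: "(i, 1) \<in> ?V" "(i, j) \<in> ?V"
      using j subsetD[OF GammaD(1)[OF A(1)] A(2)] parts_pos[of i] unfolding pol_vars_def by auto
    have "(var (i, 1) - var (i, j)) * monomial m =
        (monomial (Poly_Mapping.single (i, 1) 1 + m) - monomial (Poly_Mapping.single (i, j) 1 + m) :: (nat \<times> nat, 'a) mpol)"
      by (simp add: var_def monomial_add left_diff_distrib)
    moreover have "\<dots> \<in> ?J j"
      unfolding mem_gen_ideal_iff
    proof (intro conjI ballI diff_in_carrier)
      fix k
      assume "k \<in> Poly_Mapping.keys (monomial (Poly_Mapping.single (i, 1) 1 + m) -
          monomial (Poly_Mapping.single (i, j) 1 + m) :: (nat \<times> nat, 'a) mpol)"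
      then have "k = Poly_Mapping.single (i, 1) 1 + m \<or> k = Poly_Mapping.single (i, j) 1 + m"
        using keys_diff by fastforce
      then show "\<exists>\<sigma>\<in>Gamma n d. exp_le (gen i j \<sigma>) k" using u v A B by blast
    qed (use vars mc in \<open>auto simp: monomial_add monomial_in_carrier intro!: mpoly_ring_mult_closed\<close>)
    ultimately have "identify i j (monomial m) \<in> ?J j"
      by (intro step[OF j mc]) (simp add: idm)
    then obtain C where C: "C \<in> Gamma n d" and Cm: "exp_le (gen i j C) m"
      unfolding idm mem_gen_ideal_iff by auto
    have mem: "collapse i j (t, idx C t) \<in> X" if "t \<in> C" for t
      using exp_leD[OF Cm, of "collapse i j (t, idx C t)"] that C by (auto simp: lookup_gen lm split: if_splits)
    have or: "t \<noteq> i \<and> (t \<in> A \<and> collapse i j (t, idx C t) = collapse i j (t, idx A t) \<or>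
        t \<in> B \<and> collapse i j (t, idx C t) = collapse i j (t, idx B t))" if t: "t \<in> C" for t
    proof -
      obtain t' Y where Y: "(Y = A \<or> Y = B) \<and> t' \<in> Y \<and> t' \<noteq> i"
        and eq: "collapse i j (t, idx C t) = collapse i j (t', idx Y t')"
        using mem[OF t] unfolding X_def by blast
      have "t = t'" using arg_cong[OF eq, of fst] by simp
      then show ?thesis using Y eq by blast
    qed
    show ?thesis
    proof (intro bexI[of _ C] conjI ballI)
      show "C \<subseteq> A \<union> B - {i}" using or by blast
      fix t assume t: "t \<in> C - {..<i}"
      then have "i < t" using or[of t] by auto
      \<comment> \<open>Above \<open>i\<close> nothing has been identified, so equal collapsed
        variables have equal upper indices.\<close>
      then have "collapse i j (t, s) = (t, s)" for s by (simp add: collapse_def lex_less_def)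
      then show "t \<in> A \<and> idx C t = idx A t \<or> t \<in> B \<and> idx C t = idx B t"
        using or[of t] t by auto
    qed (rule C)
  qed
  show ?thesis
    unfolding exchange_off_def
  proof (intro ballI impI)
    fix A B assume "A \<in> Gamma n d" "B \<in> Gamma n d" "i \<in> A" "i \<in> B" "idx A i \<noteq> idx B i"
    \<comment> \<open>The conclusion is symmetric in \<open>A\<close> and \<open>B\<close>, so the
      smaller index may be taken at \<open>A\<close>.\<close>
    then show "\<exists>C\<in>Gamma n d. C \<subseteq> A \<union> B - {i} \<and>
        (\<forall>t\<in>C - {..<i}. t \<in> A \<and> idx C t = idx A t \<or> t \<in> B \<and> idx C t = idx B t)"
      using main[of A B] main[of B A] by (cases "idx A i < idx B i") (auto simp: Un_commute disj_commute)
  qed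
qed

section \<open>The whole sequence and the other clauses of a polarization\<close>

lemma one_notin_final_ideal:
  "(1 :: (nat \<times> nat, 'a::field) mpol) \<notin>
    Idl\<^bsub>mpoly_ring (pol_vars n r)\<^esub> (partitioning_ideal n d r P \<union> set (pol_sequence n r))"
proof -
  have "\<not> exp_le (gen i j \<sigma>) 0" if \<sigma>: "\<sigma> \<in> Gamma n d" for i j \<sigma>
  proof -
    \<comment> \<open>Since \<open>d \<ge> 1\<close>, every generator contains a variable and none
      collapses to 1.\<close>
    obtain t where t: "t \<in> \<sigma>" using GammaD[OF \<sigma>] d_pos by fastforce
    have "Poly_Mapping.lookup (gen i j \<sigma>) (collapse i j (t, idx \<sigma> t)) = 1"
      using t by (simp add: lookup_gen[OF \<sigma>])
    then show ?thesis by (metis exp_leD lookup_zero not_one_le_zero)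
  qed
  then show ?thesis
    unfolding set_pol_sequence
    by (simp add: mem_stage_ideal_iff one_in_carrier identify_def mem_gen_ideal_iff)
qed

lemma ideal_partitioning_ideal:
  "ideal (partitioning_ideal n d r P :: (nat \<times> nat, 'a::field) mpol set) (mpoly_ring (pol_vars n r))"
proof -
  interpret R: cring "mpoly_ring (pol_vars n r) :: (nat \<times> nat, 'a) mpol ring"
    by (rule cring_mpoly_ring)
  show ?thesis
    unfolding partitioning_ideal_def generators_eq by (rule R.genideal_ideal[OF generators_in_carrier])
qed

text \<open>At \<open>(i, j)\<close> neither \<open>(i, 1)\<close> nor \<open>(i, j)\<close> is
  moved by \<open>collapse\<close>, so \<open>identify i j\<close> leaves the current entry of the
  sequence unchanged.\<close>

lemma regular_step_iff:
  fixes a :: "(nat \<times> nat, 'a::field) mpol"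
  defines "J \<equiv> \<lambda>x. Idl\<^bsub>mpoly_ring (pol_vars n r)\<^esub> (partitioning_ideal n d r P \<union> pol_differences n r x)"
  assumes ij: "(i, j) \<in> set (pol_index n r)" and a: "a \<in> carrier (mpoly_ring (pol_vars n r))"
  shows "((var (i, 1) - var (i, j)) * a \<in> J (i, j) \<longrightarrow> a \<in> J (i, j)) \<longleftrightarrow>
    ((var (i, 1) - var (i, j)) * identify i j a \<in>
        Idl\<^bsub>mpoly_ring (pol_vars n r)\<^esub> (monomial ` gen i j ` Gamma n d) \<longrightarrow>
      identify i j a \<in> Idl\<^bsub>mpoly_ring (pol_vars n r)\<^esub> (monomial ` gen i j ` Gamma n d))"
proof -
  have "(i, 1) \<in> pol_vars n r" "(i, j) \<in> pol_vars n r" "2 \<le> j"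
    using ij by (auto simp: set_pol_index pol_vars_def)
  then have c: "(var (i, 1) - var (i, j)) * a \<in> carrier (mpoly_ring (pol_vars n r))"
    by (intro mpoly_ring_mult_closed diff_in_carrier var_in_carrier a)
  have "identify i j ((var (i, 1) - var (i, j)) * a) = (var (i, 1) - var (i, j)) * identify i j a"
    by (simp add: identify_def subst_mult subst_diff collapse_def lex_less_def)
  then show ?thesis
    using mem_stage_ideal_iff[OF c, of i j] mem_stage_ideal_iff[OF a, of i j] by (simp add: J_def)
qed

text \<open>The steps \<open>(i, j)\<close> sharing an \<open>i\<close> together amount to the
  condition at \<open>i\<close>, which is vacuous outside \<open>{1..n}\<close>. The nontriviality
  clause always holds.\<close>

lemma regular_sequence_iff_exchange:
  "regular_sequence (mpoly_ring (pol_vars n r))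
      (quot_module (mpoly_ring (pol_vars n r)) (partitioning_ideal n d r P :: (nat \<times> nat, 'a::field) mpol set))
      (pol_sequence n r) \<longleftrightarrow>
    (\<forall>i. exchange_off {..<i} (Gamma n d) idx i)" (is "?L \<longleftrightarrow> ?R")
proof -
  let ?S = "mpoly_ring (pol_vars n r) :: (nat \<times> nat, 'a) mpol ring"
  let ?J = "\<lambda>i j. Idl\<^bsub>?S\<^esub> (monomial ` gen i j ` Gamma n d)"
  define step where "step i j \<longleftrightarrow> (\<forall>a\<in>carrier ?S.
      (var (i, 1) - var (i, j)) * identify i j a \<in> ?J i j \<longrightarrow> identify i j a \<in> ?J i j)" for i j
  have car: "set (pol_sequence n r) \<subseteq> carrier ?S"
    using parts_pos unfolding pol_sequence_eq set_map set_pol_index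
    by (auto intro!: diff_in_carrier var_in_carrier simp: pol_vars_def)
  have nth: "(\<forall>a\<in>carrier ?S. pol_sequence n r ! k * a \<in>
          Idl\<^bsub>?S\<^esub> (partitioning_ideal n d r P \<union> set (take k (pol_sequence n r))) \<longrightarrow>
        a \<in> Idl\<^bsub>?S\<^esub> (partitioning_ideal n d r P \<union> set (take k (pol_sequence n r)))) \<longleftrightarrow>
      (\<lambda>(i, j). step i j) (pol_index n r ! k)" if k: "k < length (pol_index n r)" for k
  proof -
    obtain i j where ij: "pol_index n r ! k = (i, j)" by fastforce
    have mem: "(i, j) \<in> set (pol_index n r)" using k ij by (metis nth_mem)
    have seq: "pol_sequence n r ! k = (var (i, 1) - var (i, j) :: (nat \<times> nat, 'a) mpol)"
      using k ij by (simp add: pol_sequence_eq)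
    show ?thesis
      unfolding set_take_pol_sequence[OF k] ij seq step_def prod.case
      by (intro ball_cong refl regular_step_iff mem)
  qed
  have len: "length (pol_sequence n r :: (nat \<times> nat, 'a) mpol list) = length (pol_index n r)"
    by (simp add: pol_sequence_eq)
  have "?L \<longleftrightarrow> (\<forall>k<length (pol_index n r). (\<lambda>(i, j). step i j) (pol_index n r ! k))"
    unfolding regular_sequence_quot_module_iff[OF cring_mpoly_ring ideal_partitioning_ideal]
    using car nth len by (simp add: one_notin_final_ideal)
  also have "\<dots> \<longleftrightarrow> (\<forall>i j. (i, j) \<in> set (pol_index n r) \<longrightarrow> step i j)"
    unfolding all_set_conv_all_nth[symmetric] by auto
  also have "\<dots> \<longleftrightarrow> ?R"
  proof
    assume steps: "\<forall>i j. (i, j) \<in> set (pol_index n r) \<longrightarrow> step i j"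
    show ?R
    proof
      fix i
      show "exchange_off {..<i} (Gamma n d) idx i"
      proof (cases "i \<in> {1..n}")
        case True
        then have "step i j" if "j \<in> {2..r i}" for j
          using steps that by (simp add: set_pol_index)
        from this[unfolded step_def, rule_format] show ?thesis
          by (rule regular_step_imp_exchange)
      next
        case False
        then have "i \<notin> A" if "A \<in> Gamma n d" for A using GammaD(1)[OF that] by blast
        then show ?thesis by (simp add: exchange_off_def)
      qed
    qed
  next
    assume R: ?R
    show "\<forall>i j. (i, j) \<in> set (pol_index n r) \<longrightarrow> step i j"
      unfolding step_def
    proof (intro allI impI ballI)
      fix i j a
      assume ij: "(i, j) \<in> set (pol_index n r)" and a: "a \<in> carrier ?S"
        and mem: "(var (i, 1) - var (i, j)) * identify i j a \<in> ?J i j"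
      show "identify i j a \<in> ?J i j"
        by (rule exchange_imp_regular_step[OF R[rule_format] _ identify_in_carrier[OF a] mem])
          (use ij in \<open>simp add: set_pol_index\<close>)
    qed
  qed
  finally show ?thesis .
qed

text \<open>The image of an ideal is again an ideal because the homomorphism is onto: sending each
  \<open>i\<close> to \<open>(i, 1)\<close> is a section. Generators are carried to
  generators.\<close>

lemma subst_partitioning_ideal:
  "subst (\<lambda>(i, j). var i) ` (partitioning_ideal n d r P :: (nat \<times> nat, 'a::field) mpol set) = sqfree_ideal n d"
proof -
  let ?S = "mpoly_ring (pol_vars n r) :: (nat \<times> nat, 'a) mpol ring"
  let ?T = "mpoly_ring {1..n} :: (nat, 'a) mpol ring"
  let ?h = "subst (\<lambda>(i, j). var i) :: (nat \<times> nat, 'a) mpol \<Rightarrow> (nat, 'a) mpol"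
  let ?I = "partitioning_ideal n d r P :: (nat \<times> nat, 'a) mpol set"
  let ?G = "(\<lambda>\<sigma>. \<Prod>t\<in>\<sigma>. var (t, idx \<sigma> t)) ` Gamma n d :: (nat \<times> nat, 'a) mpol set"
  let ?s = "subst (\<lambda>i. var (i, 1)) :: (nat, 'a) mpol \<Rightarrow> (nat \<times> nat, 'a) mpol"
  interpret S: cring ?S by (rule cring_mpoly_ring)
  interpret T: cring ?T by (rule cring_mpoly_ring)
  interpret I: ideal ?I ?S by (rule ideal_partitioning_ideal)
  have I_eq: "?I = Idl\<^bsub>?S\<^esub> ?G" by (simp add: partitioning_ideal_def generators_eq)
  have J_eq: "(sqfree_ideal n d :: (nat, 'a) mpol set) = Idl\<^bsub>?T\<^esub> ((\<lambda>\<sigma>. \<Prod>i\<in>\<sigma>. var i) ` Gamma n d)"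
    unfolding sqfree_ideal_def by (rule arg_cong[where f = "\<lambda>X. Idl\<^bsub>?T\<^esub> X"]) auto
  have hG: "?h (\<Prod>t\<in>\<sigma>. var (t, idx \<sigma> t)) = (\<Prod>i\<in>\<sigma>. var i)" for \<sigma>
    by (simp add: subst_prod)
  have hc: "?h p \<in> carrier ?T" if "p \<in> carrier ?S" for p
    by (rule subst_in_carrier[OF that]) (auto simp: pol_vars_def intro: var_in_carrier)
  have sc: "?s p \<in> carrier ?S" if "p \<in> carrier ?T" for p
    by (rule subst_in_carrier[OF that]) (use parts_pos in \<open>auto simp: pol_vars_def intro: var_in_carrier\<close>)
  have hs: "?h (?s p) = p" if "p \<in> carrier ?T" for p
    by (rule subst_subst_id[OF that]) simp
  have gens: "(\<lambda>\<sigma>. \<Prod>i\<in>\<sigma>. var i) ` Gamma n d \<subseteq> carrier ?T"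
    using GammaD(1) by (blast intro: prod_in_carrier var_in_carrier)
  show ?thesis
  proof
    have J: "ideal (sqfree_ideal n d) ?T"
      unfolding J_eq by (rule T.genideal_ideal[OF gens])
    have K: "ideal {p \<in> carrier ?S. ?h p \<in> sqfree_ideal n d} ?S" (is "ideal ?K _")
      by (rule ideal_mpoly_vimage[OF J]) (auto simp: pol_vars_def intro: var_in_carrier)
    have "?G \<subseteq> ?K"
      using generators_in_carrier T.genideal_self[OF gens] by (auto simp: hG J_eq)
    then have "?I \<subseteq> ?K" unfolding I_eq by (rule S.genideal_minimal[OF K])
    then show "?h ` ?I \<subseteq> sqfree_ideal n d" by blast
  next
    have "ideal (?h ` ?I) ?T"
    proof (rule ideal_mpoly_ringI)
      show "?h ` ?I \<subseteq> carrier ?T" using hc I.a_subset by blast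
      show "0 \<in> ?h ` ?I" using I.zero_closed by (force intro: image_eqI[of _ _ 0])
      show "p + q \<in> ?h ` ?I" if "p \<in> ?h ` ?I" "q \<in> ?h ` ?I" for p q
        using that I.a_closed by (auto simp flip: subst_add)
      show "q * p \<in> ?h ` ?I" if p: "p \<in> ?h ` ?I" and q: "q \<in> carrier ?T" for p q
      proof -
        obtain p' where p': "p' \<in> ?I" "p = ?h p'" using p by blast
        have "q * p = ?h (?s q * p')" using hs[OF q] p'(2) by (simp add: subst_mult)
        then show ?thesis using I.I_l_closed[OF p'(1) sc[OF q]] by simp
      qed
    qed
    moreover have "(\<lambda>\<sigma>. \<Prod>i\<in>\<sigma>. var i) ` Gamma n d \<subseteq> ?h ` ?I"
    proof -
      have "?h ` ?G \<subseteq> ?h ` ?I"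
        using S.genideal_self[OF generators_in_carrier] unfolding I_eq by (rule image_mono)
      then show ?thesis by (simp add: image_image hG)
    qed
    ultimately show "sqfree_ideal n d \<subseteq> ?h ` ?I"
      unfolding J_eq by (rule T.genideal_minimal)
  qed
qed

lemma monomial_ideal_sqfree_ideal:
  "monomial_ideal {1..n} (sqfree_ideal n d :: (nat, 'a::field) mpol set)"
proof -
  let ?M = "(\<lambda>\<sigma>. \<Sum>i\<in>\<sigma>. Poly_Mapping.single i (1::nat)) ` Gamma n d"
  have "{\<Prod>i\<in>\<sigma>. var i | \<sigma>. \<sigma> \<in> Gamma n d} = (monomial ` ?M :: (nat, 'a) mpol set)"
    by (auto simp: image_image monomial_sum var_def)
  moreover have "Poly_Mapping.keys m \<subseteq> {1..n}" if m: "m \<in> ?M" for m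
  proof -
    obtain \<sigma> where \<sigma>: "\<sigma> \<in> Gamma n d" "m = (\<Sum>i\<in>\<sigma>. Poly_Mapping.single i (1::nat))"
      using m by blast
    have "Poly_Mapping.keys m \<subseteq> \<sigma>"
      using GammaD(2)[OF \<sigma>(1)]
      by (auto simp: \<sigma>(2) in_keys_iff lookup_sum lookup_single when_def split: if_splits)
    then show ?thesis using GammaD(1)[OF \<sigma>(1)] by blast
  qed
  ultimately show ?thesis
    unfolding monomial_ideal_def sqfree_ideal_def by (intro exI[of _ ?M]) auto
qed

lemma squarefree_partitioning_ideal:
  "squarefree_monomial_ideal (pol_vars n r) (partitioning_ideal n d r P :: (nat \<times> nat, 'a::field) mpol set)"
proof -
  \<comment> \<open>No pair precedes \<open>(0, 0)\<close>, so \<open>gen 0 0\<close> describes the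
    original generators, with nothing identified.\<close>
  have "(\<lambda>\<sigma>. \<Prod>t\<in>\<sigma>. var (t, idx \<sigma> t)) ` Gamma n d =
      (monomial ` gen 0 0 ` Gamma n d :: (nat \<times> nat, 'a) mpol set)"
    unfolding image_image by (rule image_cong) (simp_all add: monomial_gen collapse_def lex_less_def)
  then show ?thesis
    unfolding squarefree_monomial_ideal_def partitioning_ideal_def generators_eq
    using keys_gen by (intro exI[of _ "gen 0 0 ` Gamma n d"]) (auto simp: lookup_gen)
qed

lemma is_polarization_iff:
  "is_polarization n r (sqfree_ideal n d :: (nat, 'a::field) mpol set) (partitioning_ideal n d r P) \<longleftrightarrow>
    (\<forall>i. exchange_off {} (Gamma n d) idx i)"
proof -
  have "(\<forall>i. exchange_off {..<i} (Gamma n d) idx i) \<longleftrightarrow> (\<forall>i. exchange_off {} (Gamma n d) idx i)"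
    using exchange_off_lessThan exchange_off_mono by blast
  then show ?thesis
    unfolding is_polarization_def
    by (simp only: monomial_ideal_sqfree_ideal squarefree_partitioning_ideal subst_partitioning_ideal
        regular_sequence_iff_exchange simp_thms)
qed

end

theorem proposition3p6:
  fixes n d :: nat and r :: "nat \<Rightarrow> nat" and P :: "nat \<Rightarrow> nat \<Rightarrow> nat set set"
  assumes "1 \<le> d" and "d \<le> n"
    and "partitioning n d r P"
  shows "is_polarization n r (sqfree_ideal n d :: (nat, 'a::field) mpol set)
           (partitioning_ideal n d r P) \<longleftrightarrow>
         (\<forall>i\<in>{1..n}. \<forall>j\<in>{1..r i}. \<forall>j'\<in>{1..r i}. j \<noteq> j' \<longrightarrow>
            (\<forall>\<sigma>\<in>P i j. \<forall>\<tau>\<in>P i j'. \<exists>\<beta>. \<beta> \<subseteq> \<sigma> \<union> \<tau> \<and> card \<beta> = d \<and>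
               (\<forall>t\<in>\<beta>. \<forall>s\<in>{1..r t}. \<beta> - {t} \<in> P t s \<longrightarrow>
                  (\<sigma> \<union> {i}) - {t} \<in> P t s \<or> (\<tau> \<union> {i}) - {t} \<in> P t s)))"
proof -
  interpret polarization_partition n d r P
    by unfold_locales (rule assms)+
  show ?thesis unfolding exchange_iff by (rule is_polarization_iff)
qed

end
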